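(* The Mathieu group $M_{12}$ is generated by symbols $a,T,J,U,V$, subject to the defining relations $$T^2=J^2=(JT)^3=(Ta^2)^3=[J,a]^4=(J[J,a])^2=1,\quad a^2=[J,a]^2,\quad (aT)^2=T^{[J,a]},$$ $$U^2=(UT)^2=(UJ)^3=1,\quad a^U=[J,a],$$ $$V^2=(VT)^2=(VJ)^2=(VU)^3=1,\quad a^V=[J,a]^{-1}a,\quad [J,a]^V=[J,a]^{-1}.$$
   Context: Conventions: $[x,y]=xyx^{-1}y^{-1}$, $x^y=y^{-1}xy$; permutations are composed from right to left. The statement means that the abstract group with this presentation is isomorphic to $M_{12}$, with the symbols corresponding to the following permutations. Let $K=GF(3^2)$ with prime field $\Pi=GF(3)$, and $\zeta\in K$ with $\zeta^2=1-\zeta$ (a primitive element, so $\{1,\zeta\}$ is a $\Pi$-basis of $K$). Let $v,w$ be two distinct new points and $\Omega''=K\cup\{\infty,v,w\}$ (12 points). $M_{12}$ is the sharply 5-transitive permutation group on $\Omega''$ generated by: $a:\omega\mapsto\zeta^{-1}\omega^3$, $T:\omega\mapsto1-\omega$, $J:\omega\mapsto\omega^{-1}$ (permutations of $K\cup\{\infty\}$ extended by fixing $v,w$); $U$ given by $U(\infty)=v$, $U(v)=\infty$, $U(w)=w$, $U(\alpha+\zeta\beta)=\alpha-\zeta\beta$ for $\alpha,\beta\in\Pi$; and $V$ given by $V(\infty)=\infty$, $V(v)=w$, $V(w)=v$, $V(\omega)=\omega^3$ for $\omega\in K$. *)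

theory Defs
  imports "HOL-Algebra.Algebra" "HOL-Library.Cardinality"
begin

section \<open>Group presentations\<close>

text \<open>A letter \<open>(x, True)\<close> stands for the symbol \<open>x\<close> and \<open>(x, False)\<close> for its formal inverse.\<close>

type_synonym 'x word = "('x \<times> bool) list"

inductive word_eq :: "'x word \<Rightarrow> 'x word \<Rightarrow> bool" where
  refl: "word_eq u u"
| sym: "word_eq u v \<Longrightarrow> word_eq v u"
| trans: "word_eq u v \<Longrightarrow> word_eq v w \<Longrightarrow> word_eq u w"
| cancel: "word_eq (u @ (x, b) # (x, \<not> b) # v) (u @ v)"

definition word_class :: "'x word \<Rightarrow> 'x word set" where
  "word_class u = {v. word_eq u v}"

definition free_group :: "'x word set monoid" where
  "free_group =
    \<lparr>carrier = range word_class,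
     monoid.mult = \<lambda>A B. {w. \<exists>u\<in>A. \<exists>v\<in>B. word_eq (u @ v) w},
     one = word_class []\<rparr>"

definition free_gen :: "'x \<Rightarrow> 'x word set" where
  "free_gen x = word_class [(x, True)]"

definition normal_closure :: "('g, 'b) monoid_scheme \<Rightarrow> 'g set \<Rightarrow> 'g set" where
  "normal_closure G S = \<Inter>{N. N \<lhd> G \<and> S \<subseteq> N}"

text \<open>Relations are pairs \<open>(l, r)\<close> of elements of the free group, read as \<open>l = r\<close>.\<close>

definition relator_closure :: "('x word set \<times> 'x word set) set \<Rightarrow> 'x word set set" where
  "relator_closure R =
    normal_closure free_group ((\<lambda>(l, r). l \<otimes>\<^bsub>free_group\<^esub> inv\<^bsub>free_group\<^esub> r) ` R)"

definition presented_group :: "('x word set \<times> 'x word set) set \<Rightarrow> 'x word set set monoid" where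
  "presented_group R = free_group Mod relator_closure R"

definition presented_gen :: "('x word set \<times> 'x word set) set \<Rightarrow> 'x \<Rightarrow> 'x word set set" where
  "presented_gen R x = relator_closure R #>\<^bsub>free_group\<^esub> free_gen x"

lemma word_eq_append_right: "word_eq u v \<Longrightarrow> word_eq (u @ w) (v @ w)"
proof (induction rule: word_eq.induct)
  case (cancel u x b v)
  then show ?case using word_eq.cancel[of u x b "v @ w"] by simp
qed (rule word_eq.refl, erule word_eq.sym, erule (1) word_eq.trans)

lemma word_eq_append_left: "word_eq u v \<Longrightarrow> word_eq (w @ u) (w @ v)"
proof (induction rule: word_eq.induct)
  case (cancel u x b v)
  then show ?case using word_eq.cancel[of "w @ u" x b v] by simp
qed (rule word_eq.refl, erule word_eq.sym, erule (1) word_eq.trans)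

lemma word_eq_append: "word_eq u u' \<Longrightarrow> word_eq v v' \<Longrightarrow> word_eq (u @ v) (u' @ v')"
  by (rule word_eq.trans[OF word_eq_append_right word_eq_append_left])

lemma word_class_eq_iff: "word_class u = word_class v \<longleftrightarrow> word_eq u v"
  unfolding word_class_def set_eq_iff mem_Collect_eq
  by (metis word_eq.refl word_eq.sym word_eq.trans)

lemma carrier_free_group: "carrier free_group = range word_class"
  by (simp add: free_group_def)

lemma one_free_group: "\<one>\<^bsub>free_group\<^esub> = word_class []"
  by (simp add: free_group_def)

lemma free_group_mult: "word_class u \<otimes>\<^bsub>free_group\<^esub> word_class v = word_class (u @ v)"
proof -
  have "(\<exists>u'\<in>word_class u. \<exists>v'\<in>word_class v. word_eq (u' @ v') w) \<longleftrightarrow> word_eq (u @ v) w" for w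
    unfolding word_class_def Bex_def mem_Collect_eq
    by (metis word_eq.refl word_eq.trans word_eq_append)
  then show ?thesis by (simp add: free_group_def word_class_def)
qed

lemma word_eq_inverse: "word_eq (rev (map (\<lambda>(x, b). (x, \<not> b)) u) @ u) []"
proof (induction u)
  case Nil
  show ?case by (simp add: word_eq.refl)
next
  case (Cons l u)
  obtain x b where l: "l = (x, b)" by (cases l)
  show ?case
    using word_eq.trans[OF word_eq.cancel[of "rev (map (\<lambda>(x, b). (x, \<not> b)) u)" x "\<not> b" u] Cons.IH]
    by (simp add: l)
qed

lemma group_free_group: "group (free_group :: 'x word set monoid)"
proof (rule groupI)
  fix A assume "A \<in> carrier (free_group :: 'x word set monoid)"
  then obtain u where u: "A = word_class u" by (auto simp: free_group_def)
  have "word_class (rev (map (\<lambda>(x, b). (x, \<not> b)) u)) \<otimes>\<^bsub>free_group\<^esub> A = \<one>\<^bsub>free_group\<^esub>"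
    unfolding u free_group_mult
    by (simp add: free_group_def word_class_eq_iff word_eq_inverse)
  moreover have "word_class (rev (map (\<lambda>(x, b). (x, \<not> b)) u)) \<in> carrier free_group"
    by (simp add: free_group_def)
  ultimately show "\<exists>B\<in>carrier free_group. B \<otimes>\<^bsub>free_group\<^esub> A = \<one>\<^bsub>free_group\<^esub>" by blast
next
  show "A \<otimes>\<^bsub>free_group\<^esub> B \<in> carrier free_group"
    if "A \<in> carrier free_group" "B \<in> carrier free_group" for A B :: "'x word set"
    using that by (auto simp: carrier_free_group free_group_mult)
  show "A \<otimes>\<^bsub>free_group\<^esub> B \<otimes>\<^bsub>free_group\<^esub> C = A \<otimes>\<^bsub>free_group\<^esub> (B \<otimes>\<^bsub>free_group\<^esub> C)"
    if "A \<in> carrier free_group" "B \<in> carrier free_group" "C \<in> carrier free_group"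
    for A B C :: "'x word set"
    using that by (auto simp: carrier_free_group free_group_mult)
  show "\<one>\<^bsub>free_group\<^esub> \<otimes>\<^bsub>free_group\<^esub> A = A" if "A \<in> carrier free_group" for A :: "'x word set"
    using that by (auto simp: carrier_free_group free_group_mult one_free_group)
qed (simp add: carrier_free_group one_free_group)

lemma free_gen_in_carrier: "free_gen x \<in> carrier free_group"
  by (simp add: free_gen_def free_group_def)

section \<open>The relations\<close>

definition commutator :: "('g, 'b) monoid_scheme \<Rightarrow> 'g \<Rightarrow> 'g \<Rightarrow> 'g" where
  "commutator G x y = x \<otimes>\<^bsub>G\<^esub> y \<otimes>\<^bsub>G\<^esub> inv\<^bsub>G\<^esub> x \<otimes>\<^bsub>G\<^esub> inv\<^bsub>G\<^esub> y"

definition conjugate :: "('g, 'b) monoid_scheme \<Rightarrow> 'g \<Rightarrow> 'g \<Rightarrow> 'g" where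
  "conjugate G x y = inv\<^bsub>G\<^esub> y \<otimes>\<^bsub>G\<^esub> x \<otimes>\<^bsub>G\<^esub> y"

datatype m12_symbol = Sym_a | Sym_T | Sym_J | Sym_U | Sym_V

definition relations_on ::
    "('g, 'b) monoid_scheme \<Rightarrow> 'g \<Rightarrow> 'g \<Rightarrow> 'g \<Rightarrow> 'g \<Rightarrow> 'g \<Rightarrow> ('g \<times> 'g) set"
  where "relations_on G a T J U V = (let c = commutator G J a in
    {(T [^] (2::nat), \<one>),
     (J [^] (2::nat), \<one>),
     ((J \<otimes> T) [^] (3::nat), \<one>),
     ((T \<otimes> a [^] (2::nat)) [^] (3::nat), \<one>),
     (c [^] (4::nat), \<one>),
     ((J \<otimes> c) [^] (2::nat), \<one>),
     (a [^] (2::nat), c [^] (2::nat)),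
     ((a \<otimes> T) [^] (2::nat), conjugate G T c),
     (U [^] (2::nat), \<one>),
     ((U \<otimes> T) [^] (2::nat), \<one>),
     ((U \<otimes> J) [^] (3::nat), \<one>),
     (conjugate G a U, c),
     (V [^] (2::nat), \<one>),
     ((V \<otimes> T) [^] (2::nat), \<one>),
     ((V \<otimes> J) [^] (2::nat), \<one>),
     ((V \<otimes> U) [^] (3::nat), \<one>),
     (conjugate G a V, inv c \<otimes> a),
     (conjugate G c V, inv c)})"
  for G (structure)

definition m12_relations :: "(m12_symbol word set \<times> m12_symbol word set) set" where
  "m12_relations = relations_on free_group
     (free_gen Sym_a) (free_gen Sym_T) (free_gen Sym_J) (free_gen Sym_U) (free_gen Sym_V)"

section \<open>The permutation group\<close>

text \<open>\<open>'k\<close> is the field with nine elements.\<close>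

datatype 'k point = Fin 'k | Infty | Pt_v | Pt_w

definition prime_field :: "'k::field set" where
  "prime_field = range of_int"

fun perm_a :: "'k::field \<Rightarrow> 'k point \<Rightarrow> 'k point" where
  "perm_a \<zeta> (Fin \<omega>) = Fin (inverse \<zeta> * \<omega> ^ 3)"
| "perm_a \<zeta> Infty = Infty"
| "perm_a \<zeta> Pt_v = Pt_v"
| "perm_a \<zeta> Pt_w = Pt_w"

fun perm_T :: "'k::field point \<Rightarrow> 'k point" where
  "perm_T (Fin \<omega>) = Fin (1 - \<omega>)"
| "perm_T Infty = Infty"
| "perm_T Pt_v = Pt_v"
| "perm_T Pt_w = Pt_w"

fun perm_J :: "'k::field point \<Rightarrow> 'k point" where
  "perm_J (Fin \<omega>) = (if \<omega> = 0 then Infty else Fin (inverse \<omega>))"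
| "perm_J Infty = Fin 0"
| "perm_J Pt_v = Pt_v"
| "perm_J Pt_w = Pt_w"

fun perm_U :: "'k::field \<Rightarrow> 'k point \<Rightarrow> 'k point" where
  "perm_U \<zeta> (Fin \<omega>) = Fin (THE \<eta>. \<exists>\<alpha>\<in>prime_field. \<exists>\<beta>\<in>prime_field.
      \<omega> = \<alpha> + \<zeta> * \<beta> \<and> \<eta> = \<alpha> - \<zeta> * \<beta>)"
| "perm_U \<zeta> Infty = Pt_v"
| "perm_U \<zeta> Pt_v = Infty"
| "perm_U \<zeta> Pt_w = Pt_w"

fun perm_V :: "'k::field point \<Rightarrow> 'k point" where
  "perm_V (Fin \<omega>) = Fin (\<omega> ^ 3)"
| "perm_V Infty = Infty"
| "perm_V Pt_v = Pt_w"
| "perm_V Pt_w = Pt_v"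

fun m12_perm :: "'k::field \<Rightarrow> m12_symbol \<Rightarrow> 'k point \<Rightarrow> 'k point" where
  "m12_perm \<zeta> Sym_a = perm_a \<zeta>"
| "m12_perm \<zeta> Sym_T = perm_T"
| "m12_perm \<zeta> Sym_J = perm_J"
| "m12_perm \<zeta> Sym_U = perm_U \<zeta>"
| "m12_perm \<zeta> Sym_V = perm_V"

text \<open>The product of \<open>g\<close> and \<open>f\<close> in \<^const>\<open>BijGroup\<close> is \<open>g \<circ> f\<close>: permutations compose from
  right to left.\<close>

definition M12 :: "'k::field \<Rightarrow> ('k point \<Rightarrow> 'k point) monoid" where
  "M12 \<zeta> = subgroup_generated (BijGroup UNIV) (range (m12_perm \<zeta>))"

context
  fixes \<zeta> :: "'k::field"
  assumes card9: "CARD('k) = 9" and zeta: "\<zeta>\<^sup>2 = 1 - \<zeta>"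
begin

lemma three_eq_0: "(3::'k) = 0"
proof -
  have fin: "finite (UNIV :: 'k set)" using card9 by (intro card_ge_0_finite) simp
  have bij: "bij (\<lambda>x::'k. x + 1)" by (rule bij_betw_byWitness[where f' = "\<lambda>x. x - 1"]) auto
  have "(\<Sum>x\<in>UNIV. x) = (\<Sum>x\<in>UNIV. x + (1::'k))"
    using sum.reindex_bij_betw[OF bij, of "\<lambda>x. x"] by simp
  also have "\<dots> = (\<Sum>x\<in>UNIV. x) + of_nat CARD('k)" by (simp add: sum.distrib)
  finally have "(9::'k) = 0" by (simp add: card9)
  moreover have "(9::'k) = 3 * 3" by simp
  ultimately show ?thesis by (metis mult_eq_0_iff)
qed

lemma two_neq_0: "(2::'k) \<noteq> 0"
proof
  assume "(2::'k) = 0"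
  moreover have "(3::'k) = 2 + 1" by simp
  ultimately show False using three_eq_0 by simp
qed

lemma prime_field_eq: "(prime_field :: 'k set) = {0, 1, 2}"
proof -
  have "of_int n \<in> {0, 1, 2 :: 'k}" for n :: int
  proof -
    have "(of_int n :: 'k) = of_int (3 * (n div 3) + n mod 3)" by simp
    also have "\<dots> = of_int (n mod 3)" unfolding of_int_add of_int_mult by (simp add: three_eq_0)
    finally have *: "(of_int n :: 'k) = of_int (n mod 3)" .
    have "n mod 3 = 0 \<or> n mod 3 = 1 \<or> n mod 3 = 2" by presburger
    then show ?thesis unfolding * by auto
  qed
  moreover have "{0, 1, 2 :: 'k} \<subseteq> range of_int"
    using rangeI[of "of_int :: int \<Rightarrow> 'k" 0] rangeI[of "of_int :: int \<Rightarrow> 'k" 1]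
      rangeI[of "of_int :: int \<Rightarrow> 'k" 2] by simp
  ultimately show ?thesis unfolding prime_field_def
    by (intro equalityI image_subsetI) simp_all
qed

lemma zeta_notin_prime_field: "\<zeta> \<notin> prime_field"
proof
  assume "\<zeta> \<in> prime_field"
  then consider "\<zeta> = 0" | "\<zeta> = 1" | "\<zeta> = 2" unfolding prime_field_eq by blast
  then show False
  proof cases
    case 3
    then have "(3::'k) + 2 = 0" using zeta by (simp add: algebra_simps)
    then show False using three_eq_0 two_neq_0 by simp
  qed (use zeta in auto)
qed

lemma prime_field_coords_unique:
  assumes "\<alpha> \<in> prime_field" "\<beta> \<in> prime_field" "\<alpha>' \<in> prime_field" "\<beta>' \<in> prime_field"
    and eq: "\<alpha> + \<zeta> * \<beta> = \<alpha>' + \<zeta> * \<beta>'"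
  shows "\<alpha> = \<alpha>' \<and> \<beta> = \<beta>'"
proof (cases "\<beta> = \<beta>'")
  case True
  then show ?thesis using eq by simp
next
  case False
  have diff: "x - y \<in> prime_field" if "x \<in> prime_field" "y \<in> prime_field" for x y :: 'k
    using that unfolding prime_field_def by (auto simp flip: of_int_diff)
  have inv: "inverse d = d" if "d \<in> prime_field" for d :: 'k
  proof -
    have "(2::'k) * 2 = 3 + 1" by simp
    then have "(2::'k) * 2 = 1" by (simp only: three_eq_0 add_0)
    then have "inverse (2::'k) = 2" by (rule inverse_unique)
    then show ?thesis using that unfolding prime_field_eq by auto
  qed
  have mult: "x * y \<in> prime_field" if "x \<in> prime_field" "y \<in> prime_field" for x y :: 'k
    using that unfolding prime_field_def by (auto simp flip: of_int_mult)
  have "\<zeta> * (\<beta> - \<beta>') = \<alpha>' - \<alpha>" using eq by (simp add: algebra_simps)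
  then have "\<zeta> = (\<alpha>' - \<alpha>) * inverse (\<beta> - \<beta>')" using False by (simp add: field_simps)
  also have "\<dots> \<in> prime_field" using assms(1-4) by (simp add: inv diff mult)
  finally show ?thesis using zeta_notin_prime_field by blast
qed

lemma prime_field_coords_exist: "\<exists>\<alpha>\<in>prime_field. \<exists>\<beta>\<in>prime_field. \<omega> = \<alpha> + \<zeta> * \<beta>"
proof -
  let ?f = "\<lambda>(\<alpha>, \<beta>). \<alpha> + \<zeta> * \<beta>"
  have "(0::'k) \<noteq> 2" "(1::'k) \<noteq> 2"
    using two_neq_0 by (metis, metis add_cancel_right_right one_add_one zero_neq_one)
  then have "card (prime_field :: 'k set) = 3" unfolding prime_field_eq by simp
  moreover have "inj_on ?f (prime_field \<times> prime_field)"
    using prime_field_coords_unique by (auto simp: inj_on_def)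
  ultimately have "card (?f ` (prime_field \<times> prime_field)) = CARD('k)"
    by (simp add: card_image card_cartesian_product card9)
  moreover have "finite (UNIV :: 'k set)" using card9 by (intro card_ge_0_finite) simp
  ultimately have "?f ` (prime_field \<times> prime_field) = UNIV" by (intro card_subset_eq) auto
  then have "\<omega> \<in> ?f ` (prime_field \<times> prime_field)" by simp
  then show ?thesis by auto
qed

lemma perm_U_coords:
  assumes "\<alpha> \<in> prime_field" "\<beta> \<in> prime_field"
  shows "perm_U \<zeta> (Fin (\<alpha> + \<zeta> * \<beta>)) = Fin (\<alpha> - \<zeta> * \<beta>)"
proof -
  have "(THE \<eta>. \<exists>\<alpha>'\<in>prime_field. \<exists>\<beta>'\<in>prime_field.
      \<alpha> + \<zeta> * \<beta> = \<alpha>' + \<zeta> * \<beta>' \<and> \<eta> = \<alpha>' - \<zeta> * \<beta>') = \<alpha> - \<zeta> * \<beta>"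
  proof (rule the_equality)
    show "\<eta> = \<alpha> - \<zeta> * \<beta>"
      if "\<exists>\<alpha>'\<in>prime_field. \<exists>\<beta>'\<in>prime_field.
        \<alpha> + \<zeta> * \<beta> = \<alpha>' + \<zeta> * \<beta>' \<and> \<eta> = \<alpha>' - \<zeta> * \<beta>'" for \<eta>
      using that prime_field_coords_unique[OF assms] by metis
  qed (use assms in blast)
  then show ?thesis by simp
qed

lemma bij_m12_perm: "bij (m12_perm \<zeta> s)"
proof -
  have "CARD('k) > 0" using card9 by simp
  then have fin: "finite (UNIV :: 'k set)" by (rule card_ge_0_finite)
  have "x = Infty \<or> x = Pt_v \<or> x = Pt_w \<or> x \<in> range Fin" for x :: "'k point" by (cases x) auto
  then have "(UNIV :: 'k point set) = insert Infty (insert Pt_v (insert Pt_w (range Fin)))" by blast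
  then have finp: "finite (UNIV :: 'k point set)" using fin by (metis finite_imageI finite_insert)
  have z0: "\<zeta> \<noteq> 0" using zeta by auto
  have cube: "x = y" if "x ^ 3 = y ^ 3" for x y :: 'k
  proof -
    have "(x - y) ^ 3 = x ^ 3 - y ^ 3 - 3 * (x * y * (x - y))"
      by (simp add: power3_eq_cube algebra_simps)
    then show ?thesis using that three_eq_0 by simp
  qed
  have invol: "perm_U \<zeta> (perm_U \<zeta> x) = x" for x
  proof (cases x)
    case (Fin \<omega>)
    obtain \<alpha> \<beta> where ab: "\<alpha> \<in> prime_field" "\<beta> \<in> prime_field" "\<omega> = \<alpha> + \<zeta> * \<beta>"
      using prime_field_coords_exist by blast
    have "- \<beta> \<in> prime_field" using ab(2) unfolding prime_field_def by (auto simp flip: of_int_minus)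
    then show ?thesis
      using perm_U_coords[OF ab(1,2)] perm_U_coords[OF ab(1), of "- \<beta>"] by (simp add: Fin ab(3) del: perm_U.simps(1))
  qed auto
  have "inj (m12_perm \<zeta> s)"
  proof (cases s)
    case Sym_a
    have "perm_a \<zeta> x = perm_a \<zeta> y \<Longrightarrow> x = y" for x y
      by (cases x; cases y) (use z0 cube in auto)
    then show ?thesis by (simp add: Sym_a inj_def)
  next
    case Sym_T
    have "perm_T x = perm_T y \<Longrightarrow> x = y" for x y :: "'k point" by (cases x; cases y) auto
    then show ?thesis by (simp add: Sym_T inj_def)
  next
    case Sym_J
    have "perm_J x = perm_J y \<Longrightarrow> x = y" for x y :: "'k point"
      by (cases x; cases y) (auto split: if_splits)
    then show ?thesis by (simp add: Sym_J inj_def)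
  next
    case Sym_U
    then show ?thesis using invol by (metis injI m12_perm.simps(4))
  next
    case Sym_V
    have "perm_V x = perm_V y \<Longrightarrow> x = y" for x y :: "'k point"
      by (cases x; cases y) (use cube in auto)
    then show ?thesis by (simp add: Sym_V inj_def)
  qed
  then show ?thesis by (simp add: bij_def finite_UNIV_inj_surj[OF finp])
qed

lemma m12_perm_in_BijGroup: "m12_perm \<zeta> s \<in> carrier (BijGroup UNIV)"
  using bij_m12_perm by (simp add: BijGroup_def Bij_def)

lemma carrier_M12: "carrier (M12 \<zeta>) = generate (BijGroup UNIV) (range (m12_perm \<zeta>))"
  unfolding M12_def carrier_subgroup_generated
  using m12_perm_in_BijGroup by (simp add: Int_absorb1 image_subset_iff)

end

end

theory Submission
  imports Defs
begin

text \<open>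
  If \<open>K \<le> H = K \<union> K s K\<close>, an involution \<open>t\<close> normalizes \<open>K\<close>, and \<open>t s t = s t s\<close>, then
  \<open>H \<union> H t H\<close> is closed under multiplication.  In any group satisfying the relations, this builds
  the whole group from the quaternion group \<open>Q = \<langle>a, [J, a]\<rangle>\<close> by adjoining \<open>T\<close>, \<open>J\<close>, \<open>U\<close>, \<open>V\<close>
  in turn.  In the permutation group each step adjoins an element moving a point (\<open>0\<close>, \<open>\<infinity>\<close>, \<open>v\<close>,
  \<open>w\<close>) that the previous subgroup fixes, so an element acting trivially descends along the chain
  into \<open>Q\<close>, whose nontrivial elements move \<open>1\<close>.  Hence the action is faithful; no group orders
  have to be computed.
\<close>

section \<open>Presented groups\<close>

definition word_eval :: "('g, 'b) monoid_scheme \<Rightarrow> ('x \<Rightarrow> 'g) \<Rightarrow> 'x word \<Rightarrow> 'g" where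
  "word_eval K g w = foldr (\<lambda>(x, b) y. (if b then g x else inv\<^bsub>K\<^esub> g x) \<otimes>\<^bsub>K\<^esub> y) w \<one>\<^bsub>K\<^esub>"

context group
begin

lemma word_eval_closed:
  assumes "\<And>x. g x \<in> carrier G"
  shows "word_eval G g w \<in> carrier G"
  by (induction w) (auto simp: word_eval_def assms)

lemma word_eval_append:
  assumes "\<And>x. g x \<in> carrier G"
  shows "word_eval G g (u @ v) = word_eval G g u \<otimes> word_eval G g v"
proof (induction u)
  case Nil
  show ?case using word_eval_closed[of g v] assms by (simp add: word_eval_def)
next
  case (Cons l u)
  have "word_eval G g (l # w) = (if snd l then g (fst l) else inv g (fst l)) \<otimes> word_eval G g w" for w
    by (simp add: word_eval_def case_prod_beta)
  then show ?case using Cons assms by (simp add: m_assoc word_eval_closed)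
qed

lemma word_eval_word_eq:
  assumes g: "\<And>x. g x \<in> carrier G" and "word_eq u v"
  shows "word_eval G g u = word_eval G g v"
  using assms(2)
proof induction
  case (cancel u x b v)
  have "word_eval G g [(x, b), (x, \<not> b)] = \<one>"
    using g by (simp add: word_eval_def)
  then have "word_eval G g ([(x, b), (x, \<not> b)] @ v) = word_eval G g v"
    unfolding word_eval_append[OF g] using g by (simp add: word_eval_closed)
  then show ?case using g by (simp add: word_eval_append)
qed auto

lemma free_group_universal:
  assumes g: "\<And>x. g x \<in> carrier G"
  shows "\<exists>\<phi>\<in>hom free_group G. \<forall>x. \<phi> (free_gen x) = g x"
proof -
  \<comment> \<open>A class is evaluated at an arbitrary representative;
    \<open>word_eval_word_eq\<close> makes the value independent of the choice.\<close>
  define \<phi> where "\<phi> A = word_eval G g (SOME w. w \<in> A)" for A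
  have \<phi>: "\<phi> (word_class u) = word_eval G g u" for u
  proof -
    have "(SOME w. w \<in> word_class u) \<in> word_class u"
      by (rule someI[of _ u]) (simp add: word_class_def word_eq.refl)
    then have "word_eq u (SOME w. w \<in> word_class u)" by (simp add: word_class_def)
    then show ?thesis using word_eval_word_eq[OF g, of u] by (simp add: \<phi>_def)
  qed
  show ?thesis
  proof (rule bexI[of _ \<phi>])
    show "\<phi> \<in> hom free_group G"
      by (rule homI)
        (auto simp: carrier_free_group free_group_mult \<phi> word_eval_append word_eval_closed g)
    show "\<forall>x. \<phi> (free_gen x) = g x"
      unfolding free_gen_def \<phi> using g by (simp add: word_eval_def)
  qed
qed

lemma normal_closure_normal:
  assumes "S \<subseteq> carrier G"
  shows "normal_closure G S \<lhd> G" "S \<subseteq> normal_closure G S"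
proof -
  \<comment> \<open>The whole group belongs to the family being intersected, so the family is
    nonempty and its intersection is a subgroup.\<close>
  have "carrier G \<lhd> G" by (auto simp: normal_inv_iff subgroup_self)
  then have "subgroup (normal_closure G S) G"
    unfolding normal_closure_def
    by (intro subgroups_Inter) (use assms in \<open>auto simp: normal_inv_iff\<close>)
  then show "normal_closure G S \<lhd> G"
    by (auto simp: normal_inv_iff normal_closure_def)
qed (auto simp: normal_closure_def)

lemma normal_closure_subset:
  assumes "N \<lhd> G" "S \<subseteq> N"
  shows "normal_closure G S \<subseteq> N"
  using assms by (auto simp: normal_closure_def)

end

lemma generate_free_gen: "generate free_group (range free_gen) = carrier free_group"
proof -
  interpret F: group free_group by (rule group_free_group)
  have gens: "range free_gen \<subseteq> carrier free_group" by (auto simp: free_gen_in_carrier)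
  have inv: "inv\<^bsub>free_group\<^esub> free_gen x = word_class [(x, False)]" for x :: 'x
    by (rule F.inv_equality)
      (use word_eq.cancel[of "[]" x False "[]"] in
        \<open>auto simp: free_gen_def free_group_mult one_free_group word_class_eq_iff carrier_free_group\<close>)
  have "word_class w \<in> generate free_group (range free_gen)" for w :: "'x word"
  proof (induction w)
    case Nil
    show ?case using generate.one[of free_group] by (simp add: one_free_group)
  next
    case (Cons l w)
    obtain x b where l: "l = (x, b)" by (cases l)
    have "word_class [l] \<in> generate free_group (range free_gen)"
    proof (cases b)
      case True
      then show ?thesis using generate.incl[of "free_gen x" "range free_gen" free_group]
        by (simp add: l free_gen_def)
    next
      case False
      then show ?thesis using generate.inv[of "free_gen x" "range free_gen" free_group]
        by (simp add: l inv)
    qed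
    from generate.eng[OF this Cons.IH] show ?case by (simp add: free_group_mult)
  qed
  then show ?thesis using F.generate_incl[OF gens] by (auto simp: carrier_free_group)
qed

section \<open>Groups given by generators and relations\<close>

context
  fixes R :: "('x word set \<times> 'x word set) set"
  assumes R: "R \<subseteq> carrier free_group \<times> carrier free_group"
begin

lemma relator_closure_normal: "relator_closure R \<lhd> free_group"
proof -
  interpret F: group free_group by (rule group_free_group)
  show ?thesis unfolding relator_closure_def
    by (rule F.normal_closure_normal) (use R in auto)
qed

lemma group_presented_group: "group (presented_group R)"
  unfolding presented_group_def by (rule normal.factorgroup_is_group[OF relator_closure_normal])

lemma presented_group_hom:
  "group_hom free_group (presented_group R) ((#>\<^bsub>free_group\<^esub>) (relator_closure R))"
  using normal.r_coset_hom_Mod[OF relator_closure_normal] group_presented_group group_free_group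
  unfolding presented_group_def by (simp add: group_hom_def group_hom_axioms_def)

lemma generate_presented_gen:
  "generate (presented_group R) (range (presented_gen R)) = carrier (presented_group R)"
proof -
  interpret group_hom free_group "presented_group R" "(#>\<^bsub>free_group\<^esub>) (relator_closure R)"
    by (rule presented_group_hom)
  have "range (presented_gen R) = (#>\<^bsub>free_group\<^esub>) (relator_closure R) ` range free_gen"
    by (auto simp: presented_gen_def)
  then show ?thesis
    using generate_img[of "range free_gen"]
    by (simp add: free_gen_in_carrier generate_free_gen image_subset_iff presented_group_def carrier_FactGroup)
qed

lemma presented_relation:
  assumes "(l, r) \<in> R"
  shows "relator_closure R #>\<^bsub>free_group\<^esub> l = relator_closure R #>\<^bsub>free_group\<^esub> r"
proof -
  interpret F: group free_group by (rule group_free_group)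
  have sub: "subgroup (relator_closure R) free_group"
    using relator_closure_normal by (simp add: F.normal_inv_iff)
  have lr: "l \<in> carrier free_group" "r \<in> carrier free_group" using assms R by auto
  \<comment> \<open>The quotient of the two sides is one of the relators, and membership in the
    closure is the criterion for equal cosets.\<close>
  have "l \<otimes>\<^bsub>free_group\<^esub> inv\<^bsub>free_group\<^esub> r \<in> relator_closure R"
    unfolding relator_closure_def by (rule subsetD[OF F.normal_closure_normal(2)]) (use assms R in auto)
  then have "l \<in> relator_closure R #>\<^bsub>free_group\<^esub> r"
    using subgroup.rcos_module_rev[OF sub F.is_group lr(2) lr(1)] by simp
  then show ?thesis using F.repr_independence[OF _ lr(2) sub] by simp
qed

end

text \<open>Von Dyck's theorem: the kernel of \<open>\<phi>\<close> is normal and contains every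
  relator, hence contains their normal closure, so \<open>\<phi>\<close> factors through the
  quotient.\<close>

lemma (in group) presented_group_universal:
  assumes R: "R \<subseteq> carrier free_group \<times> carrier free_group"
    and \<phi>: "\<phi> \<in> hom free_group G" and rel: "\<And>l r. (l, r) \<in> R \<Longrightarrow> \<phi> l = \<phi> r"
  shows "\<exists>h\<in>hom (presented_group R) G. \<forall>x. h (presented_gen R x) = \<phi> (free_gen x)"
proof -
  interpret F: group_hom free_group G \<phi>
    using \<phi> group_free_group is_group by (simp add: group_hom_def group_hom_axioms_def)
  have "relator_closure R \<subseteq> kernel free_group G \<phi>"
    unfolding relator_closure_def
    by (rule F.G.normal_closure_subset) (use R rel F.normal_kernel in \<open>auto simp: kernel_def\<close>)
  then obtain h where h: "h \<in> hom (free_group Mod relator_closure R) G"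
    "\<And>x. x \<in> carrier free_group \<Longrightarrow> h (relator_closure R #>\<^bsub>free_group\<^esub> x) = \<phi> x"
    using F.FactGroup_universal_kernel[OF relator_closure_normal[OF R]] by blast
  show ?thesis unfolding presented_group_def presented_gen_def
    by (rule bexI[OF _ h(1)]) (simp add: h(2) free_gen_in_carrier)
qed

text \<open>Both sides of each relation are words in the five elements, which homomorphisms respect.
  This carries the relations of the free generators both to the presented group and to the
  permutation group.\<close>

lemma (in group_hom) relations_on_hom:
  assumes "a \<in> carrier G" "T \<in> carrier G" "J \<in> carrier G" "U \<in> carrier G" "V \<in> carrier G"
  shows "relations_on H (h a) (h T) (h J) (h U) (h V) = map_prod h h ` relations_on G a T J U V"
  using assms by (simp add: relations_on_def Let_def commutator_def conjugate_def hom_nat_pow)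

lemma (in group) relations_on_closed:
  assumes "a \<in> carrier G" "T \<in> carrier G" "J \<in> carrier G" "U \<in> carrier G" "V \<in> carrier G"
  shows "relations_on G a T J U V \<subseteq> carrier G \<times> carrier G"
  using assms by (simp add: relations_on_def Let_def commutator_def conjugate_def)

section \<open>Double coset extensions\<close>

text \<open>The shape of a doubly transitive group with point stabilizer \<open>H\<close>: one
  trivial and one further double coset. It is only a set until closure under multiplication is
  proved.\<close>

definition adjoin :: "('g, 'b) monoid_scheme \<Rightarrow> 'g set \<Rightarrow> 'g \<Rightarrow> 'g set" where
  "adjoin G H t = H \<union> {x \<otimes>\<^bsub>G\<^esub> t \<otimes>\<^bsub>G\<^esub> y | x y. x \<in> H \<and> y \<in> H}"

context group
begin

lemma involution_cancel:
  assumes "t \<in> carrier G" "t \<otimes> t = \<one>" "x \<in> carrier G"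
  shows "t \<otimes> (t \<otimes> x) = x"
  using assms by (simp flip: m_assoc)

lemma adjoin_inv:
  assumes "subgroup H G" "t \<in> carrier G" "t \<otimes> t = \<one>" "g \<in> adjoin G H t"
  shows "inv g \<in> adjoin G H t"
proof -
  have t: "inv t = t" using assms by (simp add: inv_equality)
  have "inv (x \<otimes> t \<otimes> y) = inv y \<otimes> t \<otimes> inv x" if "x \<in> H" "y \<in> H" for x y
    using that assms t by (simp add: subgroup.mem_carrier inv_mult_group m_assoc)
  then show ?thesis
    using assms subgroup.m_inv_closed[OF assms(1)] unfolding adjoin_def by auto blast
qed

lemma adjoin_mult_left:
  assumes "subgroup H G" "t \<in> carrier G" "h \<in> H" "g \<in> adjoin G H t"
  shows "h \<otimes> g \<in> adjoin G H t"
proof -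
  have "h \<otimes> (x \<otimes> t \<otimes> y) = (h \<otimes> x) \<otimes> t \<otimes> y" if "x \<in> H" "y \<in> H" for x y
    using that assms by (simp add: subgroup.mem_carrier m_assoc)
  then show ?thesis
    using assms subgroup.m_closed[OF assms(1)] unfolding adjoin_def by auto blast
qed

lemma adjoin_mult_right:
  assumes "subgroup H G" "t \<in> carrier G" "h \<in> H" "g \<in> adjoin G H t"
  shows "g \<otimes> h \<in> adjoin G H t"
proof -
  have "(x \<otimes> t \<otimes> y) \<otimes> h = x \<otimes> t \<otimes> (y \<otimes> h)" if "x \<in> H" "y \<in> H" for x y
    using that assms by (simp add: subgroup.mem_carrier m_assoc)
  then show ?thesis
    using assms subgroup.m_closed[OF assms(1)] unfolding adjoin_def by auto blast
qed

lemma adjoin_incl: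
  assumes "subgroup H G" "t \<in> carrier G"
  shows "H \<subseteq> adjoin G H t" "t \<in> adjoin G H t" "adjoin G H t \<subseteq> carrier G"
proof -
  have "t = \<one> \<otimes> t \<otimes> \<one>" using assms by simp
  then show "t \<in> adjoin G H t"
    using subgroup.one_closed[OF assms(1)] unfolding adjoin_def by blast
qed (use assms in \<open>auto simp: adjoin_def subgroup.mem_carrier\<close>)

text \<open>The only product that needs an argument is that of two elements \<open>x t y\<close> and
  \<open>x' t y'\<close>. Its middle part \<open>t (y x') t\<close> is covered by
  \<open>conj\<close>, and the outer factors are absorbed by multiplication with \<open>H\<close> on
  either side.\<close>

lemma subgroup_adjoin:
  assumes H: "subgroup H G" and t: "t \<in> carrier G" "t \<otimes> t = \<one>"
    and conj: "\<And>h. h \<in> H \<Longrightarrow> t \<otimes> h \<otimes> t \<in> adjoin G H t"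
  shows "subgroup (adjoin G H t) G"
proof (rule subgroupI)
  show "adjoin G H t \<subseteq> carrier G" "adjoin G H t \<noteq> {}"
    using adjoin_incl[OF H t(1)] by auto
  show "inv g \<in> adjoin G H t" if "g \<in> adjoin G H t" for g by (rule adjoin_inv[OF H t that])
  show "g \<otimes> g' \<in> adjoin G H t" if g: "g \<in> adjoin G H t" "g' \<in> adjoin G H t" for g g'
  proof -
    consider "g \<in> H" | "g' \<in> H"
      | x y x' y' where "x \<in> H" "y \<in> H" "x' \<in> H" "y' \<in> H" "g = x \<otimes> t \<otimes> y" "g' = x' \<otimes> t \<otimes> y'"
      using g unfolding adjoin_def by blast
    then show ?thesis
    proof cases
      case 3
      then have "g \<otimes> g' = x \<otimes> (t \<otimes> (y \<otimes> x') \<otimes> t) \<otimes> y'"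
        using t by (simp add: subgroup.mem_carrier[OF H] m_assoc)
      then show ?thesis
        using 3 by (simp add: adjoin_mult_right adjoin_mult_left conj H t subgroup.m_closed)
    qed (use adjoin_mult_left adjoin_mult_right H t g in auto)
  qed
qed

text \<open>Conjugating \<open>k s k'\<close> by \<open>t\<close> changes \<open>k\<close> and
  \<open>k'\<close> into other elements of \<open>K\<close> and, by the braid relation,
  \<open>s\<close> into \<open>s t s\<close>. The result is \<open>(k1 s) t (s k2)\<close>, which
  lies in the double coset of \<open>t\<close> over the larger group.\<close>

lemma subgroup_adjoin_adjoin:
  assumes K: "subgroup K G" and s: "s \<in> carrier G" and t: "t \<in> carrier G" "t \<otimes> t = \<one>"
    and H: "subgroup (adjoin G K s) G"
    and norm: "\<And>k. k \<in> K \<Longrightarrow> t \<otimes> k \<otimes> t \<in> K"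
    and braid: "t \<otimes> s \<otimes> t = s \<otimes> t \<otimes> s"
  shows "subgroup (adjoin G (adjoin G K s) t) G"
proof (rule subgroup_adjoin[OF H t])
  fix h assume "h \<in> adjoin G K s"
  then consider "h \<in> K" | k k' where "k \<in> K" "k' \<in> K" "h = k \<otimes> s \<otimes> k'"
    unfolding adjoin_def by blast
  then show "t \<otimes> h \<otimes> t \<in> adjoin G (adjoin G K s) t"
  proof cases
    case 1
    then show ?thesis using norm by (auto simp: adjoin_def)
  next
    case 2
    note [simp] = subgroup.mem_carrier[OF K]
    have "t \<otimes> h \<otimes> t = (t \<otimes> k \<otimes> t) \<otimes> (t \<otimes> s \<otimes> t) \<otimes> (t \<otimes> k' \<otimes> t)"
      using 2 s t by (simp add: m_assoc involution_cancel)
    also have "\<dots> = ((t \<otimes> k \<otimes> t) \<otimes> s) \<otimes> t \<otimes> (s \<otimes> (t \<otimes> k' \<otimes> t))"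
      unfolding braid using 2 s t by (simp add: m_assoc)
    finally have eq: "t \<otimes> h \<otimes> t = ((t \<otimes> k \<otimes> t) \<otimes> s) \<otimes> t \<otimes> (s \<otimes> (t \<otimes> k' \<otimes> t))" .
    have "(t \<otimes> k \<otimes> t) \<otimes> s \<in> adjoin G K s" "s \<otimes> (t \<otimes> k' \<otimes> t) \<in> adjoin G K s"
      using adjoin_incl(2)[OF K s] 2
      by (auto intro: adjoin_mult_left[OF K s norm] adjoin_mult_right[OF K s norm])
    then show ?thesis unfolding eq adjoin_def[of G "adjoin G K s"] by blast
  qed
qed

text \<open>Since \<open>t\<close> is an involution, \<open>comm\<close> says that it commutes with
  \<open>s\<close>. This lifts the hypothesis \<open>norm\<close> of
  \<open>subgroup_adjoin_adjoin\<close> from \<open>K\<close> to the next group of the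
  chain.\<close>

lemma adjoin_normalized:
  assumes K: "subgroup K G" and s: "s \<in> carrier G" and t: "t \<in> carrier G" "t \<otimes> t = \<one>"
    and norm: "\<And>k. k \<in> K \<Longrightarrow> t \<otimes> k \<otimes> t \<in> K" and comm: "t \<otimes> s \<otimes> t = s"
    and h: "h \<in> adjoin G K s"
  shows "t \<otimes> h \<otimes> t \<in> adjoin G K s"
proof -
  consider "h \<in> K" | k k' where "k \<in> K" "k' \<in> K" "h = k \<otimes> s \<otimes> k'"
    using h unfolding adjoin_def by blast
  then show ?thesis
  proof cases
    case 1
    then show ?thesis using norm by (auto simp: adjoin_def)
  next
    case 2
    note [simp] = subgroup.mem_carrier[OF K]
    have "t \<otimes> h \<otimes> t = (t \<otimes> k \<otimes> t) \<otimes> (t \<otimes> s \<otimes> t) \<otimes> (t \<otimes> k' \<otimes> t)"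
      using 2 s t by (simp add: m_assoc involution_cancel)
    then show ?thesis unfolding comm adjoin_def using 2 norm by blast
  qed
qed

lemma generate_normalized:
  assumes t: "t \<in> carrier G" "t \<otimes> t = \<one>" and S: "S \<subseteq> carrier G"
    and conj: "\<And>s. s \<in> S \<Longrightarrow> t \<otimes> s \<otimes> t \<in> generate G S"
    and "q \<in> generate G S"
  shows "t \<otimes> q \<otimes> t \<in> generate G S"
  using assms(5)
proof induction
  case one
  show ?case using t by (simp add: generate.one)
next
  case (incl h)
  then show ?case by (rule conj)
next
  case (inv h)
  have "inv t = t" using t by (simp add: inv_equality)
  then have "t \<otimes> inv h \<otimes> t = inv (t \<otimes> h \<otimes> t)"
    using inv S t by (auto simp: inv_mult_group m_assoc subset_iff)
  then show ?case using conj[OF inv] S by (simp add: generate_m_inv_closed)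
next
  case (eng h k)
  then have "h \<in> carrier G" "k \<in> carrier G" using generate_in_carrier[OF S] by auto
  then have "t \<otimes> (h \<otimes> k) \<otimes> t = (t \<otimes> h \<otimes> t) \<otimes> (t \<otimes> k \<otimes> t)"
    using t by (simp add: m_assoc involution_cancel)
  then show ?case using eng by (simp add: generate.eng)
qed

text \<open>Moving every \<open>c\<close> to the left gives the normal forms \<open>a^n\<close> and
  \<open>c a^n\<close>, and \<open>a^4 = 1\<close> reduces \<open>n\<close> modulo 4. The list may
  contain repetitions at this stage. Its grouping into elements and their inverses lets later
  arguments treat one member of each pair.\<close>

lemma generate_quaternion:
  assumes ac: "a \<in> carrier G" "c \<in> carrier G"
    and rel: "c \<otimes> c = a \<otimes> a" "c \<otimes> a \<otimes> c = a" "c [^] (4::nat) = \<one>"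
    and q: "q \<in> generate G {a, c}"
  shows "q \<in> {\<one>, a, inv a, a \<otimes> a, c, inv c, c \<otimes> a, inv (c \<otimes> a)}"
proof -
  have c4: "c \<otimes> (c \<otimes> (c \<otimes> c)) = \<one>"
    using rel(3) ac by (simp add: numeral_eq_Suc m_assoc)
  then have a4: "a [^] (4::nat) = \<one>"
  proof -
    have "a [^] (4::nat) = (a \<otimes> a) \<otimes> (a \<otimes> a)"
      using ac by (simp add: numeral_eq_Suc m_assoc)
    also have "\<dots> = \<one>"
      unfolding rel(1)[symmetric] using c4 ac by (simp add: m_assoc)
    finally show ?thesis .
  qed
  \<comment> \<open>Inserting \<open>c^4 = 1\<close> in front of \<open>a c\<close> leaves
    \<open>c (c c) (c a c)\<close>, which the relations turn into \<open>c a^2 a\<close>.\<close>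
  have ca: "a \<otimes> c = c \<otimes> a [^] (3::nat)"
  proof -
    have "a \<otimes> c = c \<otimes> (c \<otimes> (c \<otimes> c)) \<otimes> (a \<otimes> c)" unfolding c4 using ac by simp
    also have "\<dots> = c \<otimes> ((c \<otimes> c) \<otimes> (c \<otimes> a \<otimes> c))" using ac by (simp add: m_assoc)
    finally show ?thesis unfolding rel(1,2) using ac by (simp add: numeral_eq_Suc m_assoc)
  qed
  have pow: "a [^] n \<otimes> c = c \<otimes> a [^] (3 * n)" for n :: nat
  proof (induction n)
    case (Suc n)
    have "a [^] Suc n \<otimes> c = a [^] n \<otimes> (a \<otimes> c)" using ac by (simp add: m_assoc)
    also have "\<dots> = (a [^] n \<otimes> c) \<otimes> a [^] (3::nat)" unfolding ca using ac by (simp add: m_assoc)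
    also have "\<dots> = c \<otimes> a [^] (3 * Suc n)" unfolding Suc
      using ac by (simp add: m_assoc nat_pow_mult add.commute)
    finally show ?case .
  qed (use ac in simp)
  \<comment> \<open>The set of normal forms; \<open>pow\<close> makes it closed under
    multiplication, and inverses of generators are themselves normal forms.\<close>
  define E where "E = {x. \<exists>n::nat. x = a [^] n \<or> x = c \<otimes> a [^] n}"
  have E_mult: "x \<otimes> y \<in> E" if "x \<in> E" "y \<in> E" for x y
  proof -
    have "a [^] m \<otimes> a [^] n = a [^] (m + n)"
      "a [^] m \<otimes> (c \<otimes> a [^] n) = c \<otimes> a [^] (3 * m + n)"
      "c \<otimes> a [^] m \<otimes> a [^] n = c \<otimes> a [^] (m + n)"
      "c \<otimes> a [^] m \<otimes> (c \<otimes> a [^] n) = a [^] (2 + 3 * m + n)" for m n :: nat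
    proof -
      show "a [^] m \<otimes> a [^] n = a [^] (m + n)" "c \<otimes> a [^] m \<otimes> a [^] n = c \<otimes> a [^] (m + n)"
        using ac by (simp_all add: m_assoc nat_pow_mult)
      show *: "a [^] m \<otimes> (c \<otimes> a [^] n) = c \<otimes> a [^] (3 * m + n)"
      proof -
        have "a [^] m \<otimes> (c \<otimes> a [^] n) = (a [^] m \<otimes> c) \<otimes> a [^] n" using ac by (simp add: m_assoc)
        then show ?thesis unfolding pow using ac by (simp add: m_assoc nat_pow_mult)
      qed
      have "c \<otimes> a [^] m \<otimes> (c \<otimes> a [^] n) = (c \<otimes> c) \<otimes> a [^] (3 * m + n)"
        using ac * by (simp add: m_assoc)
      also have "c \<otimes> c = a [^] (2::nat)" using rel ac by (simp add: numeral_eq_Suc)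
      finally show "c \<otimes> a [^] m \<otimes> (c \<otimes> a [^] n) = a [^] (2 + 3 * m + n)"
        using ac by (simp add: nat_pow_mult add.assoc)
    qed
    then show ?thesis using that unfolding E_def by blast
  qed
  have inv_a: "inv a = a [^] (3::nat)"
    using ac a4 by (intro inv_equality) (simp_all add: numeral_eq_Suc)
  have "inv c = c \<otimes> (c \<otimes> c)"
    using ac c4 by (intro inv_equality) (simp_all add: m_assoc)
  then have inv_c: "inv c = c \<otimes> a [^] (2::nat)"
    using rel(1) ac by (simp add: numeral_eq_Suc)
  have "q \<in> E"
    using q
  proof induction
    case one
    show ?case unfolding E_def by (auto intro!: exI[of _ "0::nat"])
  next
    case (incl h)
    have "a = a [^] (1::nat)" "c = c \<otimes> a [^] (0::nat)" using ac by simp_all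
    then show ?case using incl unfolding E_def by blast
  next
    case (inv h)
    then show ?case using inv_a inv_c unfolding E_def by blast
  qed (rule E_mult)
  then obtain n :: nat where n: "q = a [^] n \<or> q = c \<otimes> a [^] n" unfolding E_def by blast
  have mod: "a [^] n = a [^] (n mod 4)"
  proof -
    have "a [^] n = (a [^] (4::nat)) [^] (n div 4) \<otimes> a [^] (n mod 4)"
      unfolding nat_pow_pow[OF ac(1)] nat_pow_mult[OF ac(1)] by simp
    then show ?thesis unfolding a4 using ac by (simp add: nat_pow_one)
  qed
  have "inv (c \<otimes> a) = inv a \<otimes> inv c" using ac by (simp add: inv_mult_group)
  also have "\<dots> = (a [^] (3::nat) \<otimes> c) \<otimes> a [^] (2::nat)"
    unfolding inv_a inv_c using ac by (simp add: m_assoc)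
  \<comment> \<open>Moving \<open>c\<close> past \<open>a^3\<close> gives \<open>a^9\<close>, and
    the remaining \<open>a^2\<close> makes the exponent 11.\<close>
  also have "\<dots> = c \<otimes> a [^] (11::nat)"
    unfolding pow using ac by (simp add: m_assoc nat_pow_mult)
  also have "\<dots> = c \<otimes> a [^] (3::nat)"
    using ac a4 nat_pow_mult[OF ac(1), of 4 "7::nat"] nat_pow_mult[OF ac(1), of 4 "3::nat"] by simp
  finally have inv_ca: "inv (c \<otimes> a) = c \<otimes> a [^] (3::nat)" .
  have "n mod 4 \<in> {0, 1, 2, 3}" by auto
  then show ?thesis
    using n unfolding mod inv_a inv_c inv_ca using ac by (auto simp: numeral_2_eq_2)
qed

end

section \<open>Consequences of the relations\<close>

text \<open>An arbitrary group generated by five elements that satisfy the relations. It is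
  interpreted below by the presented group.\<close>

locale m12_generators = group G
  for G (structure) +
  fixes a T J U V c :: 'a
  assumes gens: "a \<in> carrier G" "T \<in> carrier G" "J \<in> carrier G" "U \<in> carrier G" "V \<in> carrier G"
    and rels: "\<And>l r. (l, r) \<in> relations_on G a T J U V \<Longrightarrow> l = r"
    and generated: "generate G {a, T, J, U, V} = carrier G"
  defines "c \<equiv> commutator G J a"
begin

lemma c_closed: "c \<in> carrier G"
  using gens by (simp add: c_def commutator_def)

lemmas relation = rels[unfolded relations_on_def Let_def, folded c_def]

lemma involutions: "T \<otimes> T = \<one>" "J \<otimes> J = \<one>" "U \<otimes> U = \<one>" "V \<otimes> V = \<one>"
proof -
  have "T [^] (2::nat) = \<one>" "J [^] (2::nat) = \<one>" "U [^] (2::nat) = \<one>" "V [^] (2::nat) = \<one>"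
    by (rule relation; simp only: insert_iff simp_thms)+
  then show "T \<otimes> T = \<one>" "J \<otimes> J = \<one>" "U \<otimes> U = \<one>" "V \<otimes> V = \<one>"
    using gens by (simp_all add: numeral_eq_Suc)
qed

lemma inv_involutions: "inv T = T" "inv J = J" "inv U = U" "inv V = V"
  using gens by (simp_all add: inv_equality involutions)

lemma square_one_commute:
  assumes "s \<in> carrier G" "t \<in> carrier G" "s \<otimes> s = \<one>" "t \<otimes> t = \<one>" "(t \<otimes> s) [^] (2::nat) = \<one>"
  shows "t \<otimes> s \<otimes> t = s"
proof -
  have "(t \<otimes> s \<otimes> t) \<otimes> s = \<one>" using assms by (simp add: numeral_eq_Suc m_assoc)
  then have "inv s = t \<otimes> s \<otimes> t" using assms by (simp add: inv_equality)
  moreover have "inv s = s" using assms by (simp add: inv_equality)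
  ultimately show ?thesis by simp
qed

text \<open>The cube of \<open>t s\<close> is the product of \<open>t s t\<close> and
  \<open>s t s\<close>, and \<open>s t s\<close> is its own inverse.\<close>

lemma cube_one_braid:
  assumes "s \<in> carrier G" "t \<in> carrier G" "s \<otimes> s = \<one>" "t \<otimes> t = \<one>" "(t \<otimes> s) [^] (3::nat) = \<one>"
  shows "t \<otimes> s \<otimes> t = s \<otimes> t \<otimes> s"
proof -
  have "(t \<otimes> s \<otimes> t) \<otimes> (s \<otimes> t \<otimes> s) = \<one>" using assms by (simp add: numeral_eq_Suc m_assoc)
  then have "inv (s \<otimes> t \<otimes> s) = t \<otimes> s \<otimes> t" using assms by (simp add: inv_equality)
  moreover have "inv (s \<otimes> t \<otimes> s) = s \<otimes> t \<otimes> s"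
    using assms by (simp add: inv_equality m_assoc involution_cancel)
  ultimately show ?thesis by simp
qed

text \<open>Together with \<open>commutes\<close>, these are the Coxeter relations of the path
  \<open>T - J - U - V\<close>, of type A4: neighbours braid, the other pairs commute.\<close>

lemma braids: "J \<otimes> T \<otimes> J = T \<otimes> J \<otimes> T" "U \<otimes> J \<otimes> U = J \<otimes> U \<otimes> J" "V \<otimes> U \<otimes> V = U \<otimes> V \<otimes> U"
proof -
  have "(J \<otimes> T) [^] (3::nat) = \<one>" "(U \<otimes> J) [^] (3::nat) = \<one>" "(V \<otimes> U) [^] (3::nat) = \<one>"
    by (rule relation; simp only: insert_iff simp_thms)+
  from this[THEN cube_one_braid[rotated 4]]
  show "J \<otimes> T \<otimes> J = T \<otimes> J \<otimes> T" "U \<otimes> J \<otimes> U = J \<otimes> U \<otimes> J" "V \<otimes> U \<otimes> V = U \<otimes> V \<otimes> U"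
    using gens involutions by blast+
qed

lemma commutes: "U \<otimes> T \<otimes> U = T" "V \<otimes> T \<otimes> V = T" "V \<otimes> J \<otimes> V = J"
proof -
  have "(U \<otimes> T) [^] (2::nat) = \<one>" "(V \<otimes> T) [^] (2::nat) = \<one>" "(V \<otimes> J) [^] (2::nat) = \<one>"
    by (rule relation; simp only: insert_iff simp_thms)+
  from this[THEN square_one_commute[rotated 4]]
  show "U \<otimes> T \<otimes> U = T" "V \<otimes> T \<otimes> V = T" "V \<otimes> J \<otimes> V = J"
    using gens involutions by blast+
qed

text \<open>The first part is the relation \<open>(J c)^2 = 1\<close>; the second is the definition
  of the commutator \<open>c\<close>, with \<open>J\<close> its own inverse.\<close>

lemma conj_J: "J \<otimes> c \<otimes> J = inv c" "J \<otimes> a \<otimes> J = c \<otimes> a"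
proof -
  have "(J \<otimes> c) [^] (2::nat) = \<one>"
    by (rule relation) (simp only: insert_iff simp_thms)
  then have "(J \<otimes> c \<otimes> J) \<otimes> c = \<one>" using gens c_closed by (simp add: numeral_eq_Suc m_assoc)
  then show "J \<otimes> c \<otimes> J = inv c" using gens c_closed by (simp add: inv_equality)
  show "J \<otimes> a \<otimes> J = c \<otimes> a"
    using gens by (simp add: c_def commutator_def inv_involutions m_assoc)
qed

lemma conj_U: "U \<otimes> a \<otimes> U = c" "U \<otimes> c \<otimes> U = a"
proof -
  have "conjugate G a U = c"
    by (rule relation) (simp only: insert_iff simp_thms)
  then show *: "U \<otimes> a \<otimes> U = c" by (simp add: conjugate_def inv_involutions)
  show "U \<otimes> c \<otimes> U = a"
    using gens by (simp add: involutions m_assoc involution_cancel flip: *)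
qed

lemma conj_V: "V \<otimes> a \<otimes> V = inv c \<otimes> a" "V \<otimes> c \<otimes> V = inv c"
proof -
  have "conjugate G a V = inv c \<otimes> a" "conjugate G c V = inv c"
    by (rule relation; simp only: insert_iff simp_thms)+
  then show "V \<otimes> a \<otimes> V = inv c \<otimes> a" "V \<otimes> c \<otimes> V = inv c"
    by (simp_all add: conjugate_def inv_involutions)
qed

text \<open>The middle relation is derived by conjugating with \<open>J\<close>: since
  \<open>J a J = c a\<close> and \<open>a^2 = c^2\<close>, the square of \<open>c a\<close> is
  \<open>J c^2 J\<close>, which is the inverse of \<open>c^2\<close>, hence \<open>a^2\<close>
  because \<open>a^4 = 1\<close>. Cancelling one \<open>a\<close> finishes.\<close>

lemma quaternion_rels: "c \<otimes> c = a \<otimes> a" "c \<otimes> a \<otimes> c = a" "c [^] (4::nat) = \<one>"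
proof -
  show "c [^] (4::nat) = \<one>"
    by (rule relation) (simp only: insert_iff simp_thms)
  have "a [^] (2::nat) = c [^] (2::nat)"
    by (rule relation) (simp only: insert_iff simp_thms)
  then show cc: "c \<otimes> c = a \<otimes> a" using gens c_closed by (simp add: numeral_eq_Suc)
  have square_sq: "a \<otimes> a \<otimes> (a \<otimes> a) = \<one>"
    unfolding cc[symmetric] using \<open>c [^] (4::nat) = \<one>\<close> c_closed by (simp add: numeral_eq_Suc m_assoc)
  have "c \<otimes> a \<otimes> (c \<otimes> a) = J \<otimes> (a \<otimes> a) \<otimes> J"
    unfolding conj_J(2)[symmetric] using gens by (simp add: m_assoc involution_cancel involutions)
  also have "\<dots> = (J \<otimes> c \<otimes> J) \<otimes> (J \<otimes> c \<otimes> J)"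
    unfolding cc[symmetric] using gens c_closed by (simp add: m_assoc involution_cancel involutions)
  also have "\<dots> = inv (a \<otimes> a)"
    unfolding conj_J cc[symmetric] using c_closed by (simp add: inv_mult_group)
  also have "\<dots> = a \<otimes> a"
    using gens square_sq by (simp add: inv_equality)
  finally have "(c \<otimes> a \<otimes> c) \<otimes> a = a \<otimes> a" using gens c_closed by (simp add: m_assoc)
  then show "c \<otimes> a \<otimes> c = a" using gens c_closed by simp
qed

text \<open>In \<open>M12\<close> these are the stabilizer of \<open>0, \<infinity>, v, w\<close> (the quaternion group of order 8) and
  those of \<open>\<infinity>, v, w\<close>, of \<open>v, w\<close> and of \<open>w\<close>, followed by the whole group.\<close>

definition "Q = generate G {a, c}"
definition "B = adjoin G Q T"
definition "G10 = adjoin G B J"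
definition "G11 = adjoin G G10 U"
definition "G12 = adjoin G G11 V"

lemma ac_subset: "{a, c} \<subseteq> carrier G"
  using gens c_closed by simp

lemma ac_Q: "a \<in> Q" "c \<in> Q"
  unfolding Q_def by (auto intro: generate.incl)

lemma subgroup_Q: "subgroup Q G"
  unfolding Q_def by (rule generate_is_subgroup[OF ac_subset])

lemma Q_mult: "x \<in> Q \<Longrightarrow> y \<in> Q \<Longrightarrow> x \<otimes> y \<in> Q"
  and Q_inv: "x \<in> Q \<Longrightarrow> inv x \<in> Q"
  by (rule subgroup.m_closed[OF subgroup_Q] subgroup.m_inv_closed[OF subgroup_Q]; assumption)+

lemma Q_elements: "q \<in> Q \<Longrightarrow> q \<in> {\<one>, a, inv a, a \<otimes> a, c, inv c, c \<otimes> a, inv (c \<otimes> a)}"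
  unfolding Q_def by (rule generate_quaternion[OF gens(1) c_closed quaternion_rels])

lemma Q_normalized:
  assumes "q \<in> Q"
  shows "J \<otimes> q \<otimes> J \<in> Q" "U \<otimes> q \<otimes> U \<in> Q" "V \<otimes> q \<otimes> V \<in> Q"
proof -
  have "inv c \<in> Q" "c \<otimes> a \<in> Q" "inv c \<otimes> a \<in> Q" using ac_Q Q_mult Q_inv by blast+
  then have "J \<otimes> s \<otimes> J \<in> Q" "U \<otimes> s \<otimes> U \<in> Q" "V \<otimes> s \<otimes> V \<in> Q" if "s \<in> {a, c}" for s
    using that ac_Q conj_J conj_U conj_V by auto
  then show "J \<otimes> q \<otimes> J \<in> Q" "U \<otimes> q \<otimes> U \<in> Q" "V \<otimes> q \<otimes> V \<in> Q"
    using generate_normalized[OF gens(3) involutions(2) ac_subset]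
      generate_normalized[OF gens(4) involutions(3) ac_subset]
      generate_normalized[OF gens(5) involutions(4) ac_subset] assms
    unfolding Q_def by blast+
qed

section \<open>Conjugation of \<open>Q\<close> by \<open>T\<close>, and closure of the chain of
  subgroups\<close>

lemma conj_T_a: "T \<otimes> a \<otimes> T = inv a \<otimes> inv c \<otimes> T \<otimes> c"
proof -
  have "(a \<otimes> T) [^] (2::nat) = conjugate G T c"
    by (rule relation) (simp only: insert_iff simp_thms)
  then have "a \<otimes> (T \<otimes> a \<otimes> T) = inv c \<otimes> T \<otimes> c"
    using gens by (simp add: numeral_eq_Suc conjugate_def m_assoc)
  then have "T \<otimes> a \<otimes> T = inv a \<otimes> (inv c \<otimes> T \<otimes> c)"
    using gens c_closed by (subst inv_solve_left) simp_all
  then show ?thesis using gens c_closed by (simp add: m_assoc)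
qed

text \<open>Conjugate \<open>conj_T_a\<close> by \<open>U\<close>, which exchanges \<open>a\<close>
  and \<open>c\<close> and commutes with \<open>T\<close>.\<close>

lemma conj_T_c: "T \<otimes> c \<otimes> T = inv c \<otimes> inv a \<otimes> T \<otimes> a"
proof -
  have inv: "U \<otimes> inv a \<otimes> U = inv c" "U \<otimes> inv c \<otimes> U = inv a"
    using gens c_closed
    by (simp_all add: inv_mult_group inv_involutions m_assoc flip: conj_U(1))
       (simp_all add: involutions involution_cancel m_assoc)
  have "T \<otimes> c \<otimes> T = (U \<otimes> T \<otimes> U) \<otimes> (U \<otimes> a \<otimes> U) \<otimes> (U \<otimes> T \<otimes> U)"
    by (simp only: conj_U commutes)
  also have "\<dots> = U \<otimes> (T \<otimes> a \<otimes> T) \<otimes> U"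
    using gens by (simp add: m_assoc involution_cancel involutions)
  also have "\<dots> = (U \<otimes> inv a \<otimes> U) \<otimes> (U \<otimes> inv c \<otimes> U) \<otimes> (U \<otimes> T \<otimes> U) \<otimes> (U \<otimes> c \<otimes> U)"
    unfolding conj_T_a using gens c_closed by (simp add: m_assoc involution_cancel involutions)
  finally show ?thesis by (simp only: inv conj_U commutes)
qed

text \<open>The square of \<open>a a\<close> is trivial, so the relation
  \<open>(T a^2)^3 = 1\<close> acts as a braid relation between \<open>T\<close> and
  \<open>a a\<close>.\<close>

lemma conj_T_aa: "T \<otimes> (a \<otimes> a) \<otimes> T = a \<otimes> a \<otimes> T \<otimes> (a \<otimes> a)"
proof -
  have aa: "a \<otimes> a \<otimes> (a \<otimes> a) = \<one>"
    unfolding quaternion_rels(1)[symmetric]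
    using quaternion_rels(3) c_closed by (simp add: numeral_eq_Suc m_assoc)
  have "(T \<otimes> a [^] (2::nat)) [^] (3::nat) = \<one>"
    by (rule relation) (simp only: insert_iff simp_thms)
  then have "(T \<otimes> (a \<otimes> a) \<otimes> T) \<otimes> ((a \<otimes> a) \<otimes> T \<otimes> (a \<otimes> a)) = \<one>"
    using gens by (simp add: numeral_eq_Suc m_assoc)
  then have "inv ((a \<otimes> a) \<otimes> T \<otimes> (a \<otimes> a)) = T \<otimes> (a \<otimes> a) \<otimes> T"
    using gens by (simp add: inv_equality)
  moreover have "inv (a \<otimes> a) = a \<otimes> a"
    using gens aa by (simp add: inv_equality)
  then have "inv ((a \<otimes> a) \<otimes> T \<otimes> (a \<otimes> a)) = (a \<otimes> a) \<otimes> T \<otimes> (a \<otimes> a)"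
    using gens by (simp add: inv_mult_group inv_involutions m_assoc)
  ultimately show ?thesis by simp
qed

text \<open>The inverse of \<open>c a\<close> begins the right-hand side of \<open>conj_T_a\<close>.
  Solving that equation for it and then inverting gives the claim.\<close>

lemma conj_T_ca: "T \<otimes> (c \<otimes> a) \<otimes> T = c \<otimes> T \<otimes> inv a"
proof -
  have "T \<otimes> inv (c \<otimes> a) \<otimes> T = T \<otimes> (inv a \<otimes> inv c \<otimes> T \<otimes> c) \<otimes> inv c"
    using gens c_closed by (simp add: inv_mult_group m_assoc)
  also have "\<dots> = a \<otimes> T \<otimes> inv c"
    unfolding conj_T_a[symmetric] using gens c_closed by (simp add: m_assoc involution_cancel involutions)
  finally have "inv (T \<otimes> inv (c \<otimes> a) \<otimes> T) = inv (a \<otimes> T \<otimes> inv c)" by simp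
  then show ?thesis using gens c_closed by (simp add: inv_mult_group inv_involutions m_assoc)
qed

text \<open>At the bottom of the chain there is no braid relation to use, so the conjugates of
  \<open>Q\<close> by \<open>T\<close> are checked element by element. \<open>adjoin_inv\<close>
  deals with the inverses, leaving the four formulas above.\<close>

lemma subgroup_B: "subgroup B G"
  unfolding B_def
proof (rule subgroup_adjoin[OF subgroup_Q gens(2) involutions(1)])
  fix q assume "q \<in> Q"
  note Q_closed = subgroup.mem_carrier[OF subgroup_Q]
  have dc: "x \<otimes> T \<otimes> y \<in> adjoin G Q T" if "x \<in> Q" "y \<in> Q" for x y
    using that unfolding adjoin_def by blast
  have inv: "T \<otimes> inv x \<otimes> T \<in> adjoin G Q T" if "x \<in> Q" "T \<otimes> x \<otimes> T \<in> adjoin G Q T" for x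
    using adjoin_inv[OF subgroup_Q gens(2) involutions(1) that(2)] Q_closed[OF that(1)] gens
    by (simp add: inv_mult_group inv_involutions m_assoc)
  have one: "T \<otimes> \<one> \<otimes> T \<in> adjoin G Q T"
    using gens involutions subgroup.one_closed[OF subgroup_Q] by (simp add: adjoin_def)
  have pos: "T \<otimes> x \<otimes> T \<in> adjoin G Q T" if "x \<in> {a, a \<otimes> a, c, c \<otimes> a}" for x
    using that dc ac_Q Q_mult Q_inv by (auto simp: conj_T_a conj_T_aa conj_T_c conj_T_ca)
  show "T \<otimes> q \<otimes> T \<in> adjoin G Q T"
  proof -
    have "q = \<one> \<or> q \<in> {a, a \<otimes> a, c, c \<otimes> a} \<or> (\<exists>x\<in>{a, c, c \<otimes> a}. q = inv x)"
      using Q_elements[OF \<open>q \<in> Q\<close>] by blast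
    moreover have "{a, c, c \<otimes> a} \<subseteq> Q" using ac_Q Q_mult by blast
    ultimately show ?thesis using one pos inv by blast
  qed
qed

text \<open>The braid step with \<open>K = Q\<close>, \<open>s = T\<close>, \<open>t = J\<close>.
  The next two stages use \<open>B, J, U\<close> and \<open>G10, U, V\<close> in these
  roles.\<close>

lemma subgroup_G10: "subgroup G10 G"
  unfolding G10_def B_def
  by (rule subgroup_adjoin_adjoin[OF subgroup_Q gens(2,3) involutions(2)
        subgroup_B[unfolded B_def] Q_normalized(1) braids(1)])

text \<open>Both involutions normalize \<open>Q\<close> and commute with \<open>T\<close>. For
  \<open>U\<close> this is the input to \<open>G11\<close>; for \<open>V\<close> it is lifted once
  more, to \<open>G10\<close>, as the input to \<open>G12\<close>.\<close>

lemma B_normalized: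
  assumes "g \<in> B"
  shows "U \<otimes> g \<otimes> U \<in> B" "V \<otimes> g \<otimes> V \<in> B"
  using adjoin_normalized[OF subgroup_Q gens(2,4) involutions(3) Q_normalized(2) commutes(1)]
    adjoin_normalized[OF subgroup_Q gens(2,5) involutions(4) Q_normalized(3) commutes(2)] assms
  unfolding B_def by blast+

lemma subgroup_G11: "subgroup G11 G"
  unfolding G11_def G10_def
  by (rule subgroup_adjoin_adjoin[OF subgroup_B gens(3,4) involutions(3)
        subgroup_G10[unfolded G10_def] B_normalized(1) braids(2)])

lemma G10_normalized: "g \<in> G10 \<Longrightarrow> V \<otimes> g \<otimes> V \<in> G10"
  unfolding G10_def
  by (rule adjoin_normalized[OF subgroup_B gens(3,5) involutions(4) B_normalized(2) commutes(3)])

lemma subgroup_G12: "subgroup G12 G"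
  unfolding G12_def G11_def
  by (rule subgroup_adjoin_adjoin[OF subgroup_G10 gens(4,5) involutions(4)
        subgroup_G11[unfolded G11_def] G10_normalized braids(3)])

lemma chain: "Q \<subseteq> B" "B \<subseteq> G10" "G10 \<subseteq> G11" "G11 \<subseteq> G12"
  unfolding B_def G10_def G11_def G12_def by (auto simp: adjoin_def)

lemma G12_eq_carrier: "G12 = carrier G"
proof
  show "G12 \<subseteq> carrier G" using subgroup.subset[OF subgroup_G12] .
  have "T \<in> B" "J \<in> G10" "U \<in> G11" "V \<in> G12"
    using adjoin_incl(2)[OF subgroup_Q gens(2)] adjoin_incl(2)[OF subgroup_B gens(3)]
      adjoin_incl(2)[OF subgroup_G10 gens(4)] adjoin_incl(2)[OF subgroup_G11 gens(5)]
    by (simp_all only: B_def G10_def G11_def G12_def)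
  then have "{a, T, J, U, V} \<subseteq> G12" using ac_Q chain by blast
  then show "carrier G \<subseteq> G12" unfolding generated[symmetric]
    by (rule generate_subgroup_incl[OF _ subgroup_G12])
qed

end

section \<open>The permutations\<close>

text \<open>Nonzero field elements are indexed by their discrete logarithm, which makes
  \<open>a\<close>, \<open>J\<close> and \<open>V\<close> affine on exponents modulo 8. Indices 8 to
  11 are the points released one by one along the chain.\<close>

definition pt :: "'k::field \<Rightarrow> nat \<Rightarrow> 'k point" where
  "pt \<zeta> n = (if n < 8 then Fin (\<zeta> ^ n) else [Fin 0, Infty, Pt_v, Pt_w] ! (n - 8))"

lemma BijGroup_UNIV:
  "bij f \<Longrightarrow> bij g \<Longrightarrow> f \<otimes>\<^bsub>BijGroup UNIV\<^esub> g = f \<circ> g"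
  "bij f \<Longrightarrow> inv\<^bsub>BijGroup UNIV\<^esub> f = inv_into UNIV f"
  "\<one>\<^bsub>BijGroup UNIV\<^esub> = id"
  "f \<in> carrier (BijGroup UNIV) \<longleftrightarrow> bij f"
proof -
  have Bij: "Bij UNIV = {f. bij f}" by (auto simp: Bij_def)
  show "inv\<^bsub>BijGroup UNIV\<^esub> f = inv_into UNIV f" if "bij f"
    using inv_BijGroup[of f UNIV] that by (simp add: Bij restrict_def)
  show "bij f \<Longrightarrow> bij g \<Longrightarrow> f \<otimes>\<^bsub>BijGroup UNIV\<^esub> g = f \<circ> g" "\<one>\<^bsub>BijGroup UNIV\<^esub> = id"
    "f \<in> carrier (BijGroup UNIV) \<longleftrightarrow> bij f"
    by (auto simp: BijGroup_def Bij compose_def fun_eq_iff)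
qed

lemma BijGroup_power:
  assumes "bij f"
  shows "f [^]\<^bsub>BijGroup UNIV\<^esub> (2::nat) = f \<circ> f" "f [^]\<^bsub>BijGroup UNIV\<^esub> (3::nat) = f \<circ> f \<circ> f"
    "f [^]\<^bsub>BijGroup UNIV\<^esub> (4::nat) = f \<circ> f \<circ> f \<circ> f"
proof -
  interpret group "BijGroup (UNIV :: 'a set)" by (rule group_BijGroup)
  show "f [^]\<^bsub>BijGroup UNIV\<^esub> (2::nat) = f \<circ> f" "f [^]\<^bsub>BijGroup UNIV\<^esub> (3::nat) = f \<circ> f \<circ> f"
    "f [^]\<^bsub>BijGroup UNIV\<^esub> (4::nat) = f \<circ> f \<circ> f \<circ> f"
    using assms by (simp_all add: numeral_eq_Suc BijGroup_UNIV bij_comp)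
qed

section \<open>Arithmetic in the field with nine elements and tables of the permutations\<close>

context
  fixes \<zeta> :: "'k::field"
  assumes card9: "CARD('k) = 9" and zeta: "\<zeta>\<^sup>2 = 1 - \<zeta>"
begin

text \<open>Reduces an equation in characteristic 3 to a ring identity once the multiple of 3 is
  supplied as \<open>z\<close>.\<close>

lemma eq_mod_3: "x = y + 3 * z \<Longrightarrow> x = y" for x y z :: 'k
  using three_eq_0[OF card9 zeta] by simp

text \<open>Coordinates in the basis 1, \<open>\<zeta>\<close> with digits 0, 1, 2, found by
  repeated multiplication by \<open>\<zeta>\<close>. They connect exponents with the additive
  description needed for \<open>T\<close> and \<open>U\<close>.\<close>

lemma zeta_powers:
  "\<zeta> ^ 2 = 1 + \<zeta> * 2" "\<zeta> ^ 3 = 2 + \<zeta> * 2" "\<zeta> ^ 4 = 2" "\<zeta> ^ 5 = \<zeta> * 2"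
  "\<zeta> ^ 6 = 2 + \<zeta>" "\<zeta> ^ 7 = 1 + \<zeta>" "\<zeta> ^ 8 = 1"
proof -
  have zz: "\<zeta> * \<zeta> = 1 - \<zeta>" using zeta by (simp add: power2_eq_square)
  have step: "\<zeta> ^ Suc n = \<zeta> * x" if "\<zeta> ^ n = x" for n x using that by simp
  show 2: "\<zeta> ^ 2 = 1 + \<zeta> * 2"
    by (rule eq_mod_3[of _ _ "- \<zeta>"]) (simp add: zeta)
  show 3: "\<zeta> ^ 3 = 2 + \<zeta> * 2"
    by (rule eq_mod_3[of _ _ "- \<zeta>"])
      (use step[OF 2] zz in \<open>simp add: algebra_simps flip: mult.assoc\<close>)
  show 4: "\<zeta> ^ 4 = 2"
    by (rule eq_mod_3[of _ _ 0]) (use step[OF 3] zz in \<open>simp add: algebra_simps flip: mult.assoc\<close>)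
  show 5: "\<zeta> ^ 5 = \<zeta> * 2"
    using step[OF 4] by simp
  show 6: "\<zeta> ^ 6 = 2 + \<zeta>"
    by (rule eq_mod_3[of _ _ "- \<zeta>"]) (use step[OF 5] zz in \<open>simp add: algebra_simps flip: mult.assoc\<close>)
  show 7: "\<zeta> ^ 7 = 1 + \<zeta>"
    using step[OF 6] zz by (simp add: algebra_simps)
  show "\<zeta> ^ 8 = 1"
    using step[OF 7] zz by (simp add: algebra_simps)
qed

lemma zeta_neq_0: "\<zeta> \<noteq> 0"
  using zeta by auto

lemma zeta_power_mod: "\<zeta> ^ n = \<zeta> ^ (n mod 8)"
proof -
  have "\<zeta> ^ n = (\<zeta> ^ 8) ^ (n div 8) * \<zeta> ^ (n mod 8)"
    unfolding power_mult[symmetric] power_add[symmetric] by simp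
  then show ?thesis by (simp add: zeta_powers)
qed

text \<open>Cubing triples the exponent, and \<open>\<zeta> ^ 8 = 1\<close> turns inversion into
  multiplication of the exponent by 7.\<close>

lemma perm_power:
  assumes "n < 8"
  shows "perm_a \<zeta> (pt \<zeta> n) = pt \<zeta> ((3 * n + 7) mod 8)"
    and "perm_J (pt \<zeta> n) = pt \<zeta> (7 * n mod 8)"
    and "perm_V (pt \<zeta> n) = pt \<zeta> (3 * n mod 8)"
proof -
  have "\<zeta> * \<zeta> ^ 7 = 1" using zeta_powers(7) by (simp add: numeral_eq_Suc)
  then have inv: "inverse \<zeta> = \<zeta> ^ 7" by (rule inverse_unique)
  have "inverse \<zeta> * (\<zeta> ^ n) ^ 3 = \<zeta> ^ (3 * n + 7)"
    unfolding inv by (simp add: power_add mult.commute flip: power_mult)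
  then show "perm_a \<zeta> (pt \<zeta> n) = pt \<zeta> ((3 * n + 7) mod 8)"
    using assms by (simp add: pt_def flip: zeta_power_mod)
  have "inverse (\<zeta> ^ n) = \<zeta> ^ (7 * n)"
    unfolding power_inverse[symmetric] inv by (simp flip: power_mult)
  then show "perm_J (pt \<zeta> n) = pt \<zeta> (7 * n mod 8)"
    using assms zeta_neq_0 by (simp add: pt_def flip: zeta_power_mod)
  have "(\<zeta> ^ n) ^ 3 = \<zeta> ^ (3 * n)"
    by (simp add: mult.commute flip: power_mult)
  then show "perm_V (pt \<zeta> n) = pt \<zeta> (3 * n mod 8)"
    using assms by (simp add: pt_def flip: zeta_power_mod)
qed

lemma table_a:
  "perm_a \<zeta> (pt \<zeta> 0) = pt \<zeta> 7"
    "perm_a \<zeta> (pt \<zeta> (Suc 0)) = pt \<zeta> 2"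
    "perm_a \<zeta> (pt \<zeta> 2) = pt \<zeta> 5"
    "perm_a \<zeta> (pt \<zeta> 3) = pt \<zeta> 0"
    "perm_a \<zeta> (pt \<zeta> 4) = pt \<zeta> 3"
    "perm_a \<zeta> (pt \<zeta> 5) = pt \<zeta> 6"
    "perm_a \<zeta> (pt \<zeta> 6) = pt \<zeta> (Suc 0)"
    "perm_a \<zeta> (pt \<zeta> 7) = pt \<zeta> 4"
    "perm_a \<zeta> (pt \<zeta> 8) = pt \<zeta> 8"
    "perm_a \<zeta> (pt \<zeta> 9) = pt \<zeta> 9"
    "perm_a \<zeta> (pt \<zeta> 10) = pt \<zeta> 10"
    "perm_a \<zeta> (pt \<zeta> 11) = pt \<zeta> 11"
  using perm_power(1)[of 0] perm_power(1)[of 1] perm_power(1)[of 2] perm_power(1)[of 3]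
    perm_power(1)[of 4] perm_power(1)[of 5] perm_power(1)[of 6] perm_power(1)[of 7]
  by (simp_all) (simp_all add: pt_def)

lemma table_J:
  "perm_J (pt \<zeta> 0) = pt \<zeta> 0"
    "perm_J (pt \<zeta> (Suc 0)) = pt \<zeta> 7"
    "perm_J (pt \<zeta> 2) = pt \<zeta> 6"
    "perm_J (pt \<zeta> 3) = pt \<zeta> 5"
    "perm_J (pt \<zeta> 4) = pt \<zeta> 4"
    "perm_J (pt \<zeta> 5) = pt \<zeta> 3"
    "perm_J (pt \<zeta> 6) = pt \<zeta> 2"
    "perm_J (pt \<zeta> 7) = pt \<zeta> (Suc 0)"
    "perm_J (pt \<zeta> 8) = pt \<zeta> 9"
    "perm_J (pt \<zeta> 9) = pt \<zeta> 8"
    "perm_J (pt \<zeta> 10) = pt \<zeta> 10"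
    "perm_J (pt \<zeta> 11) = pt \<zeta> 11"
  using perm_power(2)[of 0] perm_power(2)[of 1] perm_power(2)[of 2] perm_power(2)[of 3]
    perm_power(2)[of 4] perm_power(2)[of 5] perm_power(2)[of 6] perm_power(2)[of 7]
  by (simp_all) (simp_all add: pt_def)

lemma table_V:
  "perm_V (pt \<zeta> 0) = pt \<zeta> 0"
    "perm_V (pt \<zeta> (Suc 0)) = pt \<zeta> 3"
    "perm_V (pt \<zeta> 2) = pt \<zeta> 6"
    "perm_V (pt \<zeta> 3) = pt \<zeta> (Suc 0)"
    "perm_V (pt \<zeta> 4) = pt \<zeta> 4"
    "perm_V (pt \<zeta> 5) = pt \<zeta> 7"
    "perm_V (pt \<zeta> 6) = pt \<zeta> 2"
    "perm_V (pt \<zeta> 7) = pt \<zeta> 5"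
    "perm_V (pt \<zeta> 8) = pt \<zeta> 8"
    "perm_V (pt \<zeta> 9) = pt \<zeta> 9"
    "perm_V (pt \<zeta> 10) = pt \<zeta> 11"
    "perm_V (pt \<zeta> 11) = pt \<zeta> 10"
  using perm_power(3)[of 0] perm_power(3)[of 1] perm_power(3)[of 2] perm_power(3)[of 3]
    perm_power(3)[of 4] perm_power(3)[of 5] perm_power(3)[of 6] perm_power(3)[of 7]
  by (simp_all) (simp_all add: pt_def)

text \<open>Zero and unit coefficients stay explicit so that every field point has the form
  \<open>x + \<zeta> * y\<close> to which the rule for \<open>U\<close> applies.\<close>

lemma pt_coords:
  "pt \<zeta> 0 = Fin (1 + \<zeta> * 0)" "pt \<zeta> (Suc 0) = Fin (0 + \<zeta> * 1)" "pt \<zeta> 2 = Fin (1 + \<zeta> * 2)"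
  "pt \<zeta> 3 = Fin (2 + \<zeta> * 2)" "pt \<zeta> 4 = Fin (2 + \<zeta> * 0)" "pt \<zeta> 5 = Fin (0 + \<zeta> * 2)"
  "pt \<zeta> 6 = Fin (2 + \<zeta> * 1)" "pt \<zeta> 7 = Fin (1 + \<zeta> * 1)" "pt \<zeta> 8 = Fin (0 + \<zeta> * 0)"
  by (simp_all add: pt_def zeta_powers)

lemma table_T:
  "perm_T (pt \<zeta> 0) = pt \<zeta> 8"
    "perm_T (pt \<zeta> (Suc 0)) = pt \<zeta> 2"
    "perm_T (pt \<zeta> 2) = pt \<zeta> (Suc 0)"
    "perm_T (pt \<zeta> 3) = pt \<zeta> 6"
    "perm_T (pt \<zeta> 4) = pt \<zeta> 4"
    "perm_T (pt \<zeta> 5) = pt \<zeta> 7"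
    "perm_T (pt \<zeta> 6) = pt \<zeta> 3"
    "perm_T (pt \<zeta> 7) = pt \<zeta> 5"
    "perm_T (pt \<zeta> 8) = pt \<zeta> 0"
    "perm_T (pt \<zeta> 9) = pt \<zeta> 9"
    "perm_T (pt \<zeta> 10) = pt \<zeta> 10"
    "perm_T (pt \<zeta> 11) = pt \<zeta> 11"
proof -
  have T: "perm_T (Fin x) = Fin y" if "1 - x = y" for x y :: 'k using that by simp
  show "perm_T (pt \<zeta> 0) = pt \<zeta> 8"
    "perm_T (pt \<zeta> (Suc 0)) = pt \<zeta> 2"
    "perm_T (pt \<zeta> 2) = pt \<zeta> (Suc 0)"
    "perm_T (pt \<zeta> 3) = pt \<zeta> 6"
    "perm_T (pt \<zeta> 4) = pt \<zeta> 4"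
    "perm_T (pt \<zeta> 5) = pt \<zeta> 7"
    "perm_T (pt \<zeta> 6) = pt \<zeta> 3"
    "perm_T (pt \<zeta> 7) = pt \<zeta> 5"
    "perm_T (pt \<zeta> 8) = pt \<zeta> 0"
    \<comment> \<open>Each of the two coordinates is off by 0 or by -3, which leaves these four
      candidates for the multiple of 3.\<close>
    unfolding pt_coords by (rule T, ((rule eq_mod_3[of _ _ 0] eq_mod_3[of _ _ "- 1"] eq_mod_3[of _ _ "- \<zeta>"] eq_mod_3[of _ _ "- 1 - \<zeta>"],
        simp add: algebra_simps; fail)))+
qed (simp_all add: pt_def)

lemma table_U:
  "perm_U \<zeta> (pt \<zeta> 0) = pt \<zeta> 0"
    "perm_U \<zeta> (pt \<zeta> (Suc 0)) = pt \<zeta> 5"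
    "perm_U \<zeta> (pt \<zeta> 2) = pt \<zeta> 7"
    "perm_U \<zeta> (pt \<zeta> 3) = pt \<zeta> 6"
    "perm_U \<zeta> (pt \<zeta> 4) = pt \<zeta> 4"
    "perm_U \<zeta> (pt \<zeta> 5) = pt \<zeta> (Suc 0)"
    "perm_U \<zeta> (pt \<zeta> 6) = pt \<zeta> 3"
    "perm_U \<zeta> (pt \<zeta> 7) = pt \<zeta> 2"
    "perm_U \<zeta> (pt \<zeta> 8) = pt \<zeta> 8"
    "perm_U \<zeta> (pt \<zeta> 9) = pt \<zeta> 10"
    "perm_U \<zeta> (pt \<zeta> 10) = pt \<zeta> 9"
    "perm_U \<zeta> (pt \<zeta> 11) = pt \<zeta> 11"
proof -
  have U: "perm_U \<zeta> (Fin (x + \<zeta> * y)) = Fin (x' + \<zeta> * y')"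
    if "x \<in> {0, 1, 2}" "y \<in> {0, 1, 2}" "x - \<zeta> * y = x' + \<zeta> * y'" for x y x' y' :: 'k
    using perm_U_coords[OF card9 zeta, of x y] that by (simp add: prime_field_eq[OF card9 zeta] del: perm_U.simps(1))
  show "perm_U \<zeta> (pt \<zeta> 0) = pt \<zeta> 0"
    "perm_U \<zeta> (pt \<zeta> (Suc 0)) = pt \<zeta> 5"
    "perm_U \<zeta> (pt \<zeta> 2) = pt \<zeta> 7"
    "perm_U \<zeta> (pt \<zeta> 3) = pt \<zeta> 6"
    "perm_U \<zeta> (pt \<zeta> 4) = pt \<zeta> 4"
    "perm_U \<zeta> (pt \<zeta> 5) = pt \<zeta> (Suc 0)"
    "perm_U \<zeta> (pt \<zeta> 6) = pt \<zeta> 3"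
    "perm_U \<zeta> (pt \<zeta> 7) = pt \<zeta> 2"
    "perm_U \<zeta> (pt \<zeta> 8) = pt \<zeta> 8"
    unfolding pt_coords by (rule U, simp, simp, ((rule eq_mod_3[of _ _ 0] eq_mod_3[of _ _ "- 1"] eq_mod_3[of _ _ "- \<zeta>"] eq_mod_3[of _ _ "- 1 - \<zeta>"],
        simp add: algebra_simps; fail)))+
qed (simp_all add: pt_def)

lemma pt_cases:
  "p \<in> {pt \<zeta> 0, pt \<zeta> (Suc 0), pt \<zeta> 2, pt \<zeta> 3, pt \<zeta> 4, pt \<zeta> 5, pt \<zeta> 6, pt \<zeta> 7, pt \<zeta> 8,
    pt \<zeta> 9, pt \<zeta> 10, pt \<zeta> 11}"
proof (cases p)
  case (Fin \<omega>)
  obtain x y where "x \<in> {0, 1, 2}" "y \<in> {0, 1, 2}" "\<omega> = x + \<zeta> * y"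
    using prime_field_coords_exist[OF card9 zeta, of \<omega>] unfolding prime_field_eq[OF card9 zeta] by blast
  then show ?thesis unfolding pt_coords Fin by blast
qed (simp_all add: pt_def)

lemma pt_ext:
  fixes f g :: "'k point \<Rightarrow> 'k point"
  assumes "f (pt \<zeta> 0) = g (pt \<zeta> 0)" "f (pt \<zeta> (Suc 0)) = g (pt \<zeta> (Suc 0))"
    "f (pt \<zeta> 2) = g (pt \<zeta> 2)" "f (pt \<zeta> 3) = g (pt \<zeta> 3)" "f (pt \<zeta> 4) = g (pt \<zeta> 4)"
    "f (pt \<zeta> 5) = g (pt \<zeta> 5)" "f (pt \<zeta> 6) = g (pt \<zeta> 6)" "f (pt \<zeta> 7) = g (pt \<zeta> 7)"
    "f (pt \<zeta> 8) = g (pt \<zeta> 8)" "f (pt \<zeta> 9) = g (pt \<zeta> 9)" "f (pt \<zeta> 10) = g (pt \<zeta> 10)"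
    "f (pt \<zeta> 11) = g (pt \<zeta> 11)"
  shows "f = g"
proof
  fix p
  show "f p = g p" using pt_cases[of p] assms by blast
qed

lemma bij_perms: "bij (perm_a \<zeta>)" "bij (perm_T :: 'k point \<Rightarrow> _)" "bij (perm_J :: 'k point \<Rightarrow> _)"
  "bij (perm_U \<zeta>)" "bij (perm_V :: 'k point \<Rightarrow> _)"
  using bij_m12_perm[OF card9 zeta, of Sym_a] bij_m12_perm[OF card9 zeta, of Sym_T]
    bij_m12_perm[OF card9 zeta, of Sym_J] bij_m12_perm[OF card9 zeta, of Sym_U]
    bij_m12_perm[OF card9 zeta, of Sym_V] by simp_all

section \<open>The commutator and the relations between the permutations\<close>

abbreviation "perm_c \<equiv> commutator (BijGroup UNIV) perm_J (perm_a \<zeta>)"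

lemma perm_c_eq: "perm_c = perm_J \<circ> perm_a \<zeta> \<circ> inv_into UNIV perm_J \<circ> inv_into UNIV (perm_a \<zeta>)"
  by (simp add: commutator_def BijGroup_UNIV bij_perms bij_comp bij_imp_bij_inv)

lemma bij_perm_c: "bij perm_c"
  unfolding perm_c_eq by (simp add: bij_perms bij_comp bij_imp_bij_inv)

text \<open>On the field, \<open>perm_c\<close> is multiplication by \<open>\<zeta> ^ 2\<close>:
  exponents are shifted by 2 modulo 8.\<close>

lemma table_c:
  "perm_c (pt \<zeta> 0) = pt \<zeta> 2"
    "perm_c (pt \<zeta> (Suc 0)) = pt \<zeta> 3"
    "perm_c (pt \<zeta> 2) = pt \<zeta> 4"
    "perm_c (pt \<zeta> 3) = pt \<zeta> 5"
    "perm_c (pt \<zeta> 4) = pt \<zeta> 6"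
    "perm_c (pt \<zeta> 5) = pt \<zeta> 7"
    "perm_c (pt \<zeta> 6) = pt \<zeta> 0"
    "perm_c (pt \<zeta> 7) = pt \<zeta> (Suc 0)"
    "perm_c (pt \<zeta> 8) = pt \<zeta> 8"
    "perm_c (pt \<zeta> 9) = pt \<zeta> 9"
    "perm_c (pt \<zeta> 10) = pt \<zeta> 10"
    "perm_c (pt \<zeta> 11) = pt \<zeta> 11"
  unfolding perm_c_eq
  by (simp_all add: table_a table_J
      table_a[THEN inv_f_eq[OF bij_is_inj[OF bij_perms(1)]]]
      table_J[THEN inv_f_eq[OF bij_is_inj[OF bij_perms(3)]]])

lemmas table_inv_c = table_c[THEN inv_f_eq[OF bij_is_inj[OF bij_perm_c]]]

lemma m12_perm_relations:
  assumes "(l, r) \<in> relations_on (BijGroup UNIV) (perm_a \<zeta>) perm_T perm_J (perm_U \<zeta>) perm_V"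
  shows "l = r"
proof -
  note tables = table_a table_T table_J table_U table_V table_c table_inv_c
    table_T[THEN inv_f_eq[OF bij_is_inj[OF bij_perms(2)]]]
    table_U[THEN inv_f_eq[OF bij_is_inj[OF bij_perms(4)]]]
    table_V[THEN inv_f_eq[OF bij_is_inj[OF bij_perms(5)]]]
  \<comment> \<open>Every relation becomes an equality of composed maps and is compared at the
    twelve points using the tables.\<close>
  have "\<forall>(l, r) \<in> relations_on (BijGroup UNIV) (perm_a \<zeta>) perm_T perm_J (perm_U \<zeta>) perm_V. l = r"
    unfolding relations_on_def Let_def conjugate_def
    by (simp only: ball_simps prod.case BijGroup_UNIV BijGroup_power bij_perms bij_perm_c
          bij_comp bij_imp_bij_inv simp_thms, intro conjI pt_ext)
      (simp_all only: comp_apply id_apply tables)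
  from bspec[OF this assms] show ?thesis by simp
qed

text \<open>The inequalities used for faithfulness. The first four say that \<open>a\<close>,
  \<open>a a\<close>, \<open>c\<close> and \<open>c a\<close> move the field element 1; the others
  say that \<open>T\<close>, \<open>J\<close>, \<open>U\<close>, \<open>V\<close> move the points
  with indices 8, 9, 10, 11 respectively.\<close>

lemma pt_distinct:
  "pt \<zeta> 7 \<noteq> pt \<zeta> 0" "pt \<zeta> 4 \<noteq> pt \<zeta> 0" "pt \<zeta> 2 \<noteq> pt \<zeta> 0" "pt \<zeta> (Suc 0) \<noteq> pt \<zeta> 0"
  "pt \<zeta> 0 \<noteq> pt \<zeta> 8" "pt \<zeta> 8 \<noteq> pt \<zeta> 9" "pt \<zeta> 9 \<noteq> pt \<zeta> 10" "pt \<zeta> 10 \<noteq> pt \<zeta> 11"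
proof -
  have "(2::'k) = 1 + 1" by simp
  then have "(2::'k) \<noteq> 1" by (metis add_cancel_right_right zero_neq_one)
  moreover have "\<zeta> \<noteq> 1" using zeta by auto
  ultimately show "pt \<zeta> 7 \<noteq> pt \<zeta> 0" "pt \<zeta> 4 \<noteq> pt \<zeta> 0" "pt \<zeta> 2 \<noteq> pt \<zeta> 0" "pt \<zeta> (Suc 0) \<noteq> pt \<zeta> 0"
    "pt \<zeta> 0 \<noteq> pt \<zeta> 8" "pt \<zeta> 8 \<noteq> pt \<zeta> 9" "pt \<zeta> 9 \<noteq> pt \<zeta> 10" "pt \<zeta> 10 \<noteq> pt \<zeta> 11"
    using zeta_neq_0 two_neq_0[OF card9 zeta] by (simp_all add: pt_def zeta zeta_powers)
qed

end

section \<open>Point stabilizers of a permutation action\<close>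

context group
begin

lemma hom_BijGroup_mult:
  assumes "f \<in> hom G (BijGroup UNIV)" "x \<in> carrier G" "y \<in> carrier G"
  shows "f (x \<otimes> y) p = f x (f y p)"
  using hom_mult[OF assms] hom_in_carrier[OF assms(1,2)] hom_in_carrier[OF assms(1,3)]
  by (simp add: BijGroup_UNIV)

lemma subgroup_stabilizer:
  assumes f: "f \<in> hom G (BijGroup UNIV)"
  shows "subgroup {g \<in> carrier G. f g p = p} G"
proof -
  interpret f: group_hom G "BijGroup UNIV" f
    using f is_group group_BijGroup by (simp add: group_hom_def group_hom_axioms_def)
  have one: "f \<one> p = p" using f.hom_one by (simp add: BijGroup_UNIV)
  have "f (inv g) p = p" if "g \<in> carrier G" "f g p = p" for g
    using hom_BijGroup_mult[OF f, of "inv g" g p] that one by simp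
  then show ?thesis using one
    by (intro subgroupI) (auto simp: hom_BijGroup_mult[OF f] simp del: f.hom_mult f.hom_inv)
qed

lemma adjoin_subset:
  assumes "subgroup K G" "H \<subseteq> K" "t \<in> K"
  shows "adjoin G H t \<subseteq> K"
  using assms subgroup.m_closed[OF assms(1)] unfolding adjoin_def by blast

text \<open>If \<open>x t y\<close> fixes \<open>p\<close> and so do \<open>x\<close> and
  \<open>y\<close>, then \<open>x\<close> sends both \<open>p\<close> and its image under
  \<open>t\<close> to \<open>p\<close>. Injectivity forces \<open>t\<close> to fix \<open>p\<close>,
  which is excluded.\<close>

lemma adjoin_stabilizer:
  assumes f: "f \<in> hom G (BijGroup UNIV)" and t: "t \<in> carrier G" "f t p \<noteq> p"
    and H: "H \<subseteq> {g \<in> carrier G. f g p = p}" and g: "g \<in> adjoin G H t" "f g p = p"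
  shows "g \<in> H"
proof (rule ccontr)
  assume "g \<notin> H"
  then obtain x y where xy: "x \<in> H" "y \<in> H" "g = x \<otimes> t \<otimes> y"
    using g unfolding adjoin_def by blast
  then have "f x (f t p) = f x p"
    using g(2) H t by (auto simp: hom_BijGroup_mult[OF f] subset_iff)
  moreover have "inj (f x)"
    using hom_in_carrier[OF f, of x] xy H by (auto simp: BijGroup_UNIV bij_def)
  ultimately show False using t by (simp add: inj_eq)
qed

end

section \<open>Faithfulness of the action on the twelve points\<close>

context m12_generators
begin

context
  fixes \<zeta> :: "'k::field" and f :: "'a \<Rightarrow> 'k point \<Rightarrow> 'k point"
  assumes card9: "CARD('k) = 9" and zeta: "\<zeta>\<^sup>2 = 1 - \<zeta>"
    and f: "f \<in> hom G (BijGroup UNIV)"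
    and perms: "f a = perm_a \<zeta>" "f T = perm_T" "f J = perm_J" "f U = perm_U \<zeta>" "f V = perm_V"
begin

lemma perm_c: "f c = commutator (BijGroup UNIV) perm_J (perm_a \<zeta>)"
proof -
  interpret f: group_hom G "BijGroup UNIV" f
    using f is_group group_BijGroup by (simp add: group_hom_def group_hom_axioms_def)
  show ?thesis using gens by (simp add: c_def commutator_def perms)
qed

lemmas tables = table_a[OF card9 zeta] table_T[OF card9 zeta] table_J[OF card9 zeta]
  table_U[OF card9 zeta] table_V[OF card9 zeta] table_c[OF card9 zeta]

abbreviation stab :: "nat \<Rightarrow> 'a set" where
  "stab n \<equiv> {g \<in> carrier G. f g (pt \<zeta> n) = pt \<zeta> n}"

lemma gens_stab:
  "a \<in> stab n \<and> c \<in> stab n" if "n \<in> {8, 9, 10, 11}"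
  using that gens c_closed by (auto simp: perms perm_c tables)

lemma chain_stab:
  "Q \<subseteq> stab 8" "B \<subseteq> stab 9" "G10 \<subseteq> stab 10" "G11 \<subseteq> stab 11"
proof -
  note stab = subgroup_stabilizer[OF f]
  \<comment> \<open>All four special points are tracked from the start: each later stage loses only
    the point moved by its new generator.\<close>
  have Q: "Q \<subseteq> stab n" if "n \<in> {8, 9, 10, 11}" for n
    unfolding Q_def using gens_stab[OF that] by (intro generate_subgroup_incl[OF _ stab]) auto
  have B: "B \<subseteq> stab n" if "n \<in> {9, 10, 11}" for n
    unfolding B_def using Q[of n] that gens
    by (intro adjoin_subset[OF stab]) (auto simp: perms tables)
  have G10: "G10 \<subseteq> stab n" if "n \<in> {10, 11}" for n
    unfolding G10_def using B[of n] that gens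
    by (intro adjoin_subset[OF stab]) (auto simp: perms tables)
  show "G11 \<subseteq> stab 11"
    unfolding G11_def using G10[of 11] gens
    by (intro adjoin_subset[OF stab]) (auto simp: perms tables)
  show "Q \<subseteq> stab 8" "B \<subseteq> stab 9" "G10 \<subseteq> stab 10" using Q B G10 by simp_all
qed

lemma action_faithful:
  assumes "g \<in> carrier G" "f g = id"
  shows "g = \<one>"
proof -
  have fix_pt: "f g p = p" for p using assms by simp
  have "g \<in> G12" using assms G12_eq_carrier by simp
  \<comment> \<open>Since \<open>g\<close> fixes every point, it can be pushed down one stage for
    each of \<open>w\<close>, \<open>v\<close>, infinity and 0.\<close>
  note step = adjoin_stabilizer[OF f _ _ _ _ fix_pt]
  have "g \<in> G11"
    by (rule step[OF gens(5) _ chain_stab(4)])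
      (use \<open>g \<in> G12\<close> pt_distinct[OF card9 zeta] in \<open>simp_all add: perms tables G12_def\<close>)
  then have "g \<in> G10"
    by (intro step[OF gens(4) _ chain_stab(3)])
      (use pt_distinct[OF card9 zeta] in \<open>simp_all add: perms tables G11_def\<close>)
  then have "g \<in> B"
    by (intro step[OF gens(3) _ chain_stab(2)])
      (use pt_distinct[OF card9 zeta] in \<open>simp_all add: perms tables G10_def\<close>)
  then have "g \<in> Q"
    by (intro step[OF gens(2) _ chain_stab(1)])
      (use pt_distinct[OF card9 zeta] in \<open>simp_all add: perms tables B_def\<close>)
  \<comment> \<open>Index 0 is the field element 1. A stabilizer is closed under inverses, so the
    inverses of these elements move it too.\<close>
  have "x \<notin> stab 0" if "x \<in> {a, a \<otimes> a, c, c \<otimes> a}" for x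
    using that gens c_closed pt_distinct[OF card9 zeta]
    by (auto simp: hom_BijGroup_mult[OF f] perms perm_c tables)
  moreover from this have "inv x \<notin> stab 0" if "x \<in> {a, c, c \<otimes> a}" for x
    using that subgroup.m_inv_closed[OF subgroup_stabilizer[OF f], of "inv x" "pt \<zeta> 0"] gens c_closed
    by auto
  moreover have "g \<in> stab 0" using assms by simp
  ultimately show "g = \<one>" using Q_elements[OF \<open>g \<in> Q\<close>] by blast
qed

end

end

section \<open>The isomorphism\<close>

lemma m12_relations_closed:
  "m12_relations \<subseteq> carrier free_group \<times> carrier free_group"
  unfolding m12_relations_def
  by (intro group.relations_on_closed group_free_group free_gen_in_carrier)

lemma m12_generators_presented_group:
  "m12_generators (presented_group m12_relations)
    (presented_gen m12_relations Sym_a) (presented_gen m12_relations Sym_T)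
    (presented_gen m12_relations Sym_J) (presented_gen m12_relations Sym_U)
    (presented_gen m12_relations Sym_V)"
proof -
  let ?P = "presented_group m12_relations" and ?g = "presented_gen m12_relations"
  interpret group_hom free_group ?P "(#>\<^bsub>free_group\<^esub>) (relator_closure m12_relations)"
    by (rule presented_group_hom[OF m12_relations_closed])
  show ?thesis
  proof
    show "?g Sym_a \<in> carrier ?P" "?g Sym_T \<in> carrier ?P" "?g Sym_J \<in> carrier ?P"
      "?g Sym_U \<in> carrier ?P" "?g Sym_V \<in> carrier ?P"
      unfolding presented_gen_def by (rule hom_closed[OF free_gen_in_carrier])+
    \<comment> \<open>The relations in the quotient are the images of \<open>m12_relations\<close>
      under the coset map, so their two sides are equal cosets.\<close>
    show "l = r" if "(l, r) \<in> relations_on ?P (?g Sym_a) (?g Sym_T) (?g Sym_J) (?g Sym_U) (?g Sym_V)"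
      for l r
      using that presented_relation[OF m12_relations_closed]
      unfolding presented_gen_def relations_on_hom[OF free_gen_in_carrier free_gen_in_carrier
          free_gen_in_carrier free_gen_in_carrier free_gen_in_carrier]
      by (auto simp flip: m12_relations_def)
    have "x \<in> {Sym_a, Sym_T, Sym_J, Sym_U, Sym_V}" for x by (cases x) simp_all
    then have "range ?g = ?g ` {Sym_a, Sym_T, Sym_J, Sym_U, Sym_V}" by blast
    then show "generate ?P {?g Sym_a, ?g Sym_T, ?g Sym_J, ?g Sym_U, ?g Sym_V} = carrier ?P"
      using generate_presented_gen[OF m12_relations_closed] by simp
  qed
qed

theorem proposition7p4:
  fixes \<zeta> :: "'k::field"
  assumes "CARD('k) = 9"
    and "\<zeta>\<^sup>2 = 1 - \<zeta>"
  shows "\<exists>h \<in> iso (presented_group m12_relations) (M12 \<zeta>).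
           \<forall>s. h (presented_gen m12_relations s) = m12_perm \<zeta> s"
proof -
  let ?P = "presented_group m12_relations" and ?S = "BijGroup (UNIV :: 'k point set)"
  interpret P: m12_generators ?P "presented_gen m12_relations Sym_a" "presented_gen m12_relations Sym_T"
    "presented_gen m12_relations Sym_J" "presented_gen m12_relations Sym_U" "presented_gen m12_relations Sym_V"
    "commutator ?P (presented_gen m12_relations Sym_J) (presented_gen m12_relations Sym_a)"
    by (rule m12_generators_presented_group)
  interpret S: group ?S by (rule group_BijGroup)
  obtain \<phi> where \<phi>: "\<phi> \<in> hom free_group ?S" "\<And>s. \<phi> (free_gen s) = m12_perm \<zeta> s"
    using S.free_group_universal[of "m12_perm \<zeta>"] m12_perm_in_BijGroup[OF assms] by blast
  interpret \<phi>: group_hom free_group ?S \<phi>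
    using \<phi>(1) group_free_group by (simp add: group_hom_def group_hom_axioms_def S.is_group)
  have "\<phi> l = \<phi> r" if "(l, r) \<in> m12_relations" for l r
  proof (rule m12_perm_relations[OF assms])
    have "map_prod \<phi> \<phi> (l, r) \<in> map_prod \<phi> \<phi> ` m12_relations" using that by (rule imageI)
    then show "(\<phi> l, \<phi> r) \<in> relations_on ?S (perm_a \<zeta>) perm_T perm_J (perm_U \<zeta>) perm_V"
      unfolding m12_relations_def
      by (simp add: \<phi>(2) free_gen_in_carrier flip: \<phi>.relations_on_hom)
  qed
  then obtain h where h: "h \<in> hom ?P ?S" "\<And>s. h (presented_gen m12_relations s) = m12_perm \<zeta> s"
    using S.presented_group_universal[OF m12_relations_closed \<phi>(1)] \<phi>(2) by auto
  interpret h: group_hom ?P ?S h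
    using h(1) by (simp add: group_hom_def group_hom_axioms_def S.is_group P.is_group)
  \<comment> \<open>The image of a generated group is generated by the images of the generators,
    here exactly the permutations generating \<open>M12\<close>.\<close>
  have "h ` carrier ?P = carrier (M12 \<zeta>)"
    using h.generate_img[of "range (presented_gen m12_relations)"] h(2)
      generate_presented_gen[OF m12_relations_closed] carrier_M12[OF assms]
      generate.incl[of _ "range (presented_gen m12_relations)" ?P]
    by (auto simp: image_image image_subset_iff)
  \<comment> \<open>Triviality of the kernel is faithfulness of the action of the presented group
    through \<open>h\<close>.\<close>
  moreover have "x = \<one>\<^bsub>?P\<^esub>" if "x \<in> carrier ?P" "h x = \<one>\<^bsub>?S\<^esub>" for x
    using P.action_faithful[OF assms h(1)] that h(2) by (simp add: BijGroup_UNIV)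
  ultimately have "h \<in> iso ?P (M12 \<zeta>)"
    using h.inj_iff_trivial_ker
    by (auto simp: iso_def bij_betw_def hom_def M12_def h.inj_on_one_iff)
  then show ?thesis using h(2) by blast
qed

end
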